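(* Assume the Continuum Hypothesis. Let $K$ be a Valdivia compact space admitting a dense $\Sigma$-subset $A$ such that some point of $K\setminus A$ is the limit of a nontrivial convergent sequence in $K$. Then there exists a nontrivial twisted sum of $c_0$ and $C(K)$.
   Context: For a compact Hausdorff space $K$, $C(K)$ is the Banach space of continuous real-valued functions on $K$ with the supremum norm; $c_0$ is the Banach space of real sequences converging to zero. For Banach spaces $Y,X$, a twisted sum of $Y$ and $X$ is a short exact sequence $0\to Y\to Z\to X\to 0$ with $Z$ a Banach space and bounded linear maps; it is trivial if the image of $Y\to Z$ is complemented in $Z$. For an index set $I$, $\Sigma(I)=\{x\in\mathbb R^I:\{i: x_i\neq0\}\text{ is countable}\}$. A subset $A$ of a compact Hausdorff space $K$ is a $\Sigma$-subset if there exist an index set $I$ and a continuous injection $\varphi:K\to\mathbb R^I$ with $A=\varphi^{-1}[\Sigma(I)]$; $K$ is a Valdivia compactum if it admits a dense $\Sigma$-subset. A nontrivial sequence is one that is not eventually constant. *)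

theory Defs
  imports "HOL-Analysis.Analysis" "HOL-Library.Equipollence"
begin

definition CH :: bool where
  "CH \<longleftrightarrow> (\<forall>S::real set. infinite S \<longrightarrow> S \<approx> (UNIV::nat set) \<or> S \<approx> (UNIV::real set))"

definition Sigma_prod :: "('i \<Rightarrow> real) set" where
  "Sigma_prod = {x. countable {i. x i \<noteq> 0}}"

(* c_0, as the closed subspace of l_infinity = (nat =>C real) of sequences tending to 0
  (with the supremum norm inherited from l_infinity). *)
definition c0 :: "(nat \<Rightarrow>\<^sub>C real) set" where
  "c0 = {x. (\<lambda>n. apply_bcontfun x n) \<longlonglongrightarrow> 0}"

definition normed_on :: "'v::real_vector set \<Rightarrow> ('v \<Rightarrow> real) \<Rightarrow> bool" where
  "normed_on Z N \<longleftrightarrow> subspace Z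
     \<and> (\<forall>x\<in>Z. 0 \<le> N x)
     \<and> (\<forall>x\<in>Z. N x = 0 \<longleftrightarrow> x = 0)
     \<and> (\<forall>x\<in>Z. \<forall>y\<in>Z. N (x + y) \<le> N x + N y)
     \<and> (\<forall>x\<in>Z. \<forall>c. N (c *\<^sub>R x) = \<bar>c\<bar> * N x)"

definition banach_on :: "'v::real_vector set \<Rightarrow> ('v \<Rightarrow> real) \<Rightarrow> bool" where
  "banach_on Z N \<longleftrightarrow> normed_on Z N
     \<and> (\<forall>s. (\<forall>n. s n \<in> Z) \<and> (\<forall>e>0. \<exists>M. \<forall>m\<ge>M. \<forall>n\<ge>M. N (s m - s n) < e)
            \<longrightarrow> (\<exists>z\<in>Z. (\<lambda>n. N (s n - z)) \<longlonglongrightarrow> 0))"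

definition bounded_linear_between ::
  "'v::real_vector set \<Rightarrow> ('v \<Rightarrow> real) \<Rightarrow> 'w::real_vector set \<Rightarrow> ('w \<Rightarrow> real) \<Rightarrow> ('v \<Rightarrow> 'w) \<Rightarrow> bool" where
  "bounded_linear_between D N1 E N2 f \<longleftrightarrow>
     (\<forall>x\<in>D. f x \<in> E)
     \<and> (\<forall>x\<in>D. \<forall>y\<in>D. f (x + y) = f x + f y)
     \<and> (\<forall>x\<in>D. \<forall>c. f (c *\<^sub>R x) = c *\<^sub>R f x)
     \<and> (\<exists>C. \<forall>x\<in>D. N2 (f x) \<le> C * N1 x)"

definition twisted_sum ::
  "'y::real_vector set \<Rightarrow> ('y \<Rightarrow> real) \<Rightarrow> 'x::real_vector set \<Rightarrow> ('x \<Rightarrow> real)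
   \<Rightarrow> 'z::real_vector set \<Rightarrow> ('z \<Rightarrow> real) \<Rightarrow> ('y \<Rightarrow> 'z) \<Rightarrow> ('z \<Rightarrow> 'x) \<Rightarrow> bool" where
  "twisted_sum Y NY X NX Z NZ i q \<longleftrightarrow>
     banach_on Z NZ
     \<and> bounded_linear_between Y NY Z NZ i
     \<and> bounded_linear_between Z NZ X NX q
     \<and> inj_on i Y
     \<and> q ` Z = X
     \<and> i ` Y = {z\<in>Z. q z = 0}"

definition complemented_in :: "'z::real_vector set \<Rightarrow> 'z set \<Rightarrow> ('z \<Rightarrow> real) \<Rightarrow> bool" where
  "complemented_in M Z N \<longleftrightarrow>
     (\<exists>W. subspace W \<and> W \<subseteq> Z
        \<and> (\<forall>s z. (\<forall>n. s n \<in> W) \<and> z \<in> Z \<and> (\<lambda>n. N (s n - z)) \<longlonglongrightarrow> 0 \<longrightarrow> z \<in> W)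
        \<and> M \<inter> W = {0}
        \<and> {m + w | m w. m \<in> M \<and> w \<in> W} = Z)"

definition nontrivial_twisted_sum_c0_CK :: "'a::topological_space itself \<Rightarrow> bool" where
  "nontrivial_twisted_sum_c0_CK _ \<longleftrightarrow>
     (\<exists>(Z :: ((nat \<Rightarrow>\<^sub>C real) \<times> ('a \<Rightarrow>\<^sub>C real)) set) NZ i (q :: _ \<Rightarrow> ('a \<Rightarrow>\<^sub>C real)).
        twisted_sum c0 norm UNIV norm Z NZ i q \<and> \<not> complemented_in (i ` c0) Z NZ)"

end

theory Submission
  imports Defs
begin

text \<open>
  The twisted sum is the pullback of the quotient map from $\ell_\infty$ onto $\ell_\infty/c_0$
  along an operator $T$ from $C(K)$ to $\ell_\infty/c_0$; it is trivial only if $T$ lifts to a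
  bounded operator $S$ into $\ell_\infty$. Here $T f = \sum_c \gamma_c(f) [1_{M_c}]$, where the
  $M_c$ are almost disjoint sets of integers and $(\gamma_c(f))_c$ vanishes at infinity.

  Let $s_n \to x$ with all $s_n$ different from $x$ and outside of $A$, so that every $s_n$ has
  uncountable support. Truncating coordinates to suitable countable sets maps these points back into
  $K$, and CH yields pairs $L_c \subseteq H_c$ of such sets, indexed by all sequences $c = (B_n)_n$
  of sets of integers, whose differences are pairwise disjoint and meet every support. With
  $\gamma_c(f) = f(s_n|H_c) - f(s_n|L_c) - f(x|H_c) + f(x|L_c)$, where $n = \nu(c)$, the
  Stone-Weierstrass theorem gives $\gamma_c(f) \to 0$ along the index set.

  There are functions $0 \le F_c \le 1$ with $\gamma_c(F_c) = 1$ that live on pairwise disjoint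
  open sets for different values of $\nu(c)$. If $S$ is a lift, the sets
  $B_n = \{k : |(S F_c)_k| \ge 1/2 \mbox{ for some } c \mbox{ with } \nu(c) = n\}$ have overlap at most
  $2\|S\|$, and $B_{\nu(c)}$ contains almost all of $M_c$. But CH allows a diagonal choice of $M$
  and $\nu$ for which $M_B$ is disjoint from $B_{\nu(B)}$ for every $B$ of bounded overlap.
\<close>

subsection \<open>The closed graph theorem\<close>

lemma complete_UNIV_bcontfun:
  "complete (UNIV :: ('a::topological_space \<Rightarrow>\<^sub>C 'b::complete_space) set)"
proof (rule completeI)
  fix f :: "nat \<Rightarrow> 'a \<Rightarrow>\<^sub>C 'b"
  assume "Cauchy f"
  then obtain l where "uniform_limit UNIV (\<lambda>n. apply_bcontfun (f n)) l sequentially"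
    using uniformly_convergent_eq_cauchy[of "\<lambda>_. True" f]
    unfolding Cauchy_def uniform_limit_sequentially_iff
    by (metis dist_fun_lt_imp_dist_val_lt)
  then show "\<exists>l\<in>UNIV. f \<longlonglongrightarrow> l"
    using uniform_limit_bcontfunE[of f l sequentially] by auto
qed

text \<open>By Baire, the closure of some sublevel set of \<open>norm (S x)\<close> contains a ball.
  Differences and rescaling then approximate every \<open>x\<close> arbitrarily well by points
  \<open>a\<close> with \<open>norm (S a)\<close> at most \<open>D * norm x\<close>. Iterating on
  the remainders writes \<open>x\<close> as a series whose image converges, and the closed graph
  identifies the limit with \<open>S x\<close>.\<close>

lemma closed_graph_imp_bounded:
  fixes S :: "'x::real_normed_vector \<Rightarrow> 'y::real_normed_vector"
  assumes comx: "complete (UNIV :: 'x set)" and comy: "complete (UNIV :: 'y set)"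
    and lin: "linear S"
    and graph: "\<And>s x y. s \<longlonglongrightarrow> x \<Longrightarrow> (\<lambda>n. S (s n)) \<longlonglongrightarrow> y \<Longrightarrow> y = S x"
  obtains C where "\<And>x. norm (S x) \<le> C * norm x"
proof -
  interpret S: linear S by fact
  define F where "F n = closure {x. norm (S x) \<le> real n}" for n :: nat
  have Fn: "\<exists>n. x \<in> F n" for x
    using real_arch_simple[of "norm (S x)"] closure_subset unfolding F_def by fastforce
  have "\<exists>n. interior (F n) \<noteq> {}"
  proof (rule ccontr)
    assume "\<not> ?thesis"
    then have "Met_TC.mtopology interior_of \<Union>(range F) = {}"
      using comx
      by (intro Met_TC.metric_Baire_category_alt) (auto simp: F_def Met_TC.mcomplete_def complete_def)
    moreover have "\<Union>(range F) = UNIV" using Fn by auto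
    ultimately show False by simp
  qed
  then obtain n x0 r where r: "r > 0" "cball x0 r \<subseteq> F n"
    by (metis all_not_in_conv mem_interior_cball)
  define D where "D = 2 * real n / r"
  have approx: "\<exists>a. norm (x - a) < e \<and> norm (S a) \<le> D * norm x" if "e > 0" for x e
  proof (cases "x = 0")
    case True
    then show ?thesis using that by (intro exI[of _ 0]) simp
  next
    case False
    \<comment> \<open>This puts \<open>x0 + c *\<^sub>R x\<close> on the boundary of the ball.
      Subtracting an approximant of \<open>x0\<close> from one of this point and dividing by
      \<open>c\<close> gives an approximant of \<open>x\<close>.\<close>
    define c where "c = r / norm x"
    have c: "c > 0" using False r by (simp add: c_def)
    have "x0 + c *\<^sub>R x \<in> F n" "x0 \<in> F n"
      using r False by (auto simp: c_def dist_norm intro!: subsetD[OF r(2)])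
    then obtain u v where uv: "norm (S u) \<le> n" "norm (S v) \<le> n"
       "norm (u - (x0 + c *\<^sub>R x)) < c * e / 2" "norm (v - x0) < c * e / 2"
      using c \<open>e > 0\<close> unfolding F_def closure_approachable dist_norm
      by (metis (no_types, lifting) half_gt_zero mem_Collect_eq mult_pos_pos)
    define a where "a = (1/c) *\<^sub>R (u - v)"
    have "c *\<^sub>R (x - a) = (v - x0) - (u - (x0 + c *\<^sub>R x))"
      using c by (simp add: a_def algebra_simps)
    then have "norm (c *\<^sub>R (x - a)) < c * e"
      using uv(3,4) norm_triangle_ineq4[of "v - x0" "u - (x0 + c *\<^sub>R x)"] by simp
    then have 1: "norm (x - a) < e" using c by simp
    have "norm (S u - S v) \<le> 2 * n"
      using uv norm_triangle_ineq4[of "S u" "S v"] by simp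
    then have "norm (S a) \<le> 2 * n / c"
      using c by (simp add: a_def S.scaleR S.diff divide_right_mono)
    then have "norm (S a) \<le> D * norm x" using False r by (simp add: D_def c_def mult.commute)
    with 1 show ?thesis by blast
  qed
  have D: "D \<ge> 0" using r by (simp add: D_def)
  have "norm (S x) \<le> (2 * D) * norm x" for x
  proof (cases "x = 0")
    case True then show ?thesis by simp
  next
    case False
    \<comment> \<open>The tolerances halve, so the \<open>k\<close>-th remainder has norm at most
      \<open>norm x\<close> divided by 2^k. The images of the successive corrections are dominated
      by a geometric series with sum \<open>2 * D * norm x\<close>.\<close>
    define e where "e k = norm x * (1/2) ^ Suc k" for k :: nat
    have e: "e k > 0" for k using False by (simp add: e_def)
    define h where "h k z = (SOME a. norm (z - a) < e k \<and> norm (S a) \<le> D * norm z)" for k z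
    have h: "norm (z - h k z) < e k" "norm (S (h k z)) \<le> D * norm z" for z k
      using someI_ex[OF approx[OF e[of k], of z]] by (auto simp: h_def)
    define z where "z = rec_nat x (\<lambda>k y. y - h k y)"
    have z0: "z 0 = x" and zS: "z (Suc k) = z k - h k (z k)" for k by (auto simp: z_def)
    have zn: "norm (z k) \<le> norm x * (1/2) ^ k" for k
    proof (cases k)
      case (Suc j) then show ?thesis using h(1)[of "z j" j] by (simp add: zS e_def)
    qed (simp add: z0)
    have sums: "(\<Sum>k<N. h k (z k)) = x - z N" for N
      by (induction N) (auto simp: z0 zS)
    have "(\<lambda>k. norm x * (1/2) ^ k) \<longlonglongrightarrow> 0"
      using tendsto_mult_left[OF LIMSEQ_power_zero[of "1/2::real"], of "norm x"] by simp
    then have "z \<longlonglongrightarrow> 0"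
      by (rule Lim_null_comparison[OF always_eventually, rotated]) (use zn in auto)
    then have lim: "(\<lambda>N. \<Sum>k<N. h k (z k)) \<longlonglongrightarrow> x"
      unfolding sums using tendsto_diff[OF tendsto_const, of z 0 sequentially x] by simp
    have bd: "norm (S (h k (z k))) \<le> D * norm x * (1/2) ^ k" for k
    proof -
      have "norm (S (h k (z k))) \<le> D * norm (z k)" by (rule h)
      also have "\<dots> \<le> D * (norm x * (1/2) ^ k)" using zn D by (intro mult_left_mono)
      finally show ?thesis by (simp only: mult.assoc)
    qed
    have gs: "(\<lambda>k. D * norm x * (1/2) ^ k) sums (D * norm x * 2)"
      using sums_mult[OF geometric_sums[of "1/2::real"], of "D * norm x"] by simp
    have "Cauchy (\<lambda>N. \<Sum>k<N. S (h k (z k)))"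
    proof (rule CauchyI')
      fix \<epsilon> :: real assume "\<epsilon> > 0"
      moreover have "Cauchy (\<lambda>N. \<Sum>k<N. D * norm x * (1/2) ^ k)"
        using gs by (auto simp: sums_def intro: LIMSEQ_imp_Cauchy)
      ultimately obtain M where M: "\<And>m N. m \<ge> M \<Longrightarrow> N \<ge> M \<Longrightarrow>
          norm ((\<Sum>k<N. D * norm x * (1/2) ^ k) - (\<Sum>k<m. D * norm x * (1/2) ^ k)) < \<epsilon>"
        unfolding Cauchy_iff by meson
      have "dist (\<Sum>k<m. S (h k (z k))) (\<Sum>k<N. S (h k (z k))) < \<epsilon>" if "m \<ge> M" "m < N" for m N
      proof -
        have "norm (\<Sum>k\<in>{m..<N}. S (h k (z k))) \<le> (\<Sum>k\<in>{m..<N}. D * norm x * (1/2) ^ k)"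
          by (intro sum_norm_le bd)
        also have "\<dots> = (\<Sum>k<N. D * norm x * (1/2) ^ k) - (\<Sum>k<m. D * norm x * (1/2) ^ k)"
          using that sum_diff_nat_ivl[of 0 m N "\<lambda>k. D * norm x * (1/2) ^ k"]
          by (simp add: atLeast0LessThan)
        also have "\<dots> < \<epsilon>" using M[of m N] that by simp
        finally have "norm ((\<Sum>k<N. S (h k (z k))) - (\<Sum>k<m. S (h k (z k)))) < \<epsilon>"
          using that sum_diff_nat_ivl[of 0 m N "\<lambda>k. S (h k (z k))"]
          by (simp add: atLeast0LessThan)
        then show ?thesis by (simp add: dist_norm norm_minus_commute)
      qed
      then show "\<exists>M. \<forall>m\<ge>M. \<forall>n>m. dist (\<Sum>k<m. S (h k (z k))) (\<Sum>k<n. S (h k (z k))) < \<epsilon>"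
        by blast
    qed
    then obtain y where y: "(\<lambda>N. \<Sum>k<N. S (h k (z k))) \<longlonglongrightarrow> y"
      using comy by (auto simp: complete_def)
    have "(\<lambda>N. S (\<Sum>k<N. h k (z k))) \<longlonglongrightarrow> y" using y by (simp add: S.sum)
    with lim have "y = S x" by (rule graph)
    moreover have "norm y \<le> 2 * D * norm x"
    proof (rule Lim_norm_ubound[OF _ y])
      show "\<forall>\<^sub>F N in sequentially. norm (\<Sum>k<N. S (h k (z k))) \<le> 2 * D * norm x"
      proof (rule always_eventually, rule allI)
        fix N
        have "norm (\<Sum>k<N. S (h k (z k))) \<le> (\<Sum>k<N. D * norm x * (1/2) ^ k)"
          by (intro sum_norm_le bd)
        also have "\<dots> \<le> D * norm x * 2"
          using sum_le_suminf[OF sums_summable[OF gs], of "{..<N}"] D sums_unique[OF gs] by simp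
        finally show "norm (\<Sum>k<N. S (h k (z k))) \<le> 2 * D * norm x" by (simp add: mult_ac)
      qed
    qed simp
    ultimately show ?thesis by simp
  qed
  then show ?thesis by (rule that)
qed

subsection \<open>The pullback twisted sum\<close>

lemma c0_iff: "y \<in> c0 \<longleftrightarrow> (\<forall>e>0. finite {k. e \<le> \<bar>apply_bcontfun y k\<bar>})"
  by (auto simp: c0_def tendsto_iff eventually_cofinite cofinite_eq_sequentially[symmetric] not_less)

lemma abs_apply_le_norm: "\<bar>apply_bcontfun f x\<bar> \<le> norm f" for f :: "'a::topological_space \<Rightarrow>\<^sub>C real"
  using norm_bounded[of f x] by simp

text \<open>Almost disjointness makes the indicators of the sets \<open>A a\<close> behave modulo
  \<open>c0\<close> like disjointly supported functions, and \<open>vanishing\<close> makes the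
  coefficients \<open>g a f\<close> a null family. This is what a bounded operator into the quotient
  of l_infinity by \<open>c0\<close> needs.\<close>

locale almost_disjoint_functionals =
  fixes A :: "'c \<Rightarrow> nat set" and g :: "'c \<Rightarrow> 'x::real_normed_vector \<Rightarrow> real" and D :: real
  assumes complete: "complete (UNIV :: 'x set)"
    and almost_disjoint: "a \<noteq> b \<Longrightarrow> finite (A a \<inter> A b)"
    and linear: "linear (g a)"
    and bounded: "\<bar>g a f\<bar> \<le> D * norm f"
    and vanishing: "e > 0 \<Longrightarrow> finite {a. e \<le> \<bar>g a f\<bar>}"
begin

text \<open>The first condition says that \<open>y\<close> tends to \<open>g a f\<close> along each \<open>A a\<close>, the second that \<open>y\<close> is
  small off finitely many of the \<open>A a\<close>; together they determine \<open>y\<close> modulo \<open>c0\<close>. This expresses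
  membership in the pullback without the quotient space.\<close>

definition Z :: "((nat \<Rightarrow>\<^sub>C real) \<times> 'x) set" where
  "Z = {(y, f). (\<forall>a. \<forall>e>0. finite {k \<in> A a. e \<le> \<bar>apply_bcontfun y k - g a f\<bar>})
     \<and> (\<forall>e>0. \<exists>G. finite G \<and> finite {k. k \<notin> \<Union>(A ` G) \<and> e \<le> \<bar>apply_bcontfun y k\<bar>})}"

lemma ZI:
  assumes "\<And>a e. e > 0 \<Longrightarrow> finite {k \<in> A a. e \<le> \<bar>apply_bcontfun y k - g a f\<bar>}"
    and "\<And>e. e > 0 \<Longrightarrow> \<exists>G. finite G \<and> finite {k. k \<notin> \<Union>(A ` G) \<and> e \<le> \<bar>apply_bcontfun y k\<bar>}"
  shows "(y, f) \<in> Z"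
  using assms by (simp add: Z_def)

lemma ZD1: "(y, f) \<in> Z \<Longrightarrow> e > 0 \<Longrightarrow> finite {k \<in> A a. e \<le> \<bar>apply_bcontfun y k - g a f\<bar>}"
  by (simp add: Z_def)

lemma ZD2: "(y, f) \<in> Z \<Longrightarrow> e > 0 \<Longrightarrow>
    \<exists>G. finite G \<and> finite {k. k \<notin> \<Union>(A ` G) \<and> e \<le> \<bar>apply_bcontfun y k\<bar>}"
  by (simp add: Z_def)

lemma g_linear_simps: "g a 0 = 0" "g a (f + h) = g a f + g a h" "g a (f - h) = g a f - g a h"
    "g a (c *\<^sub>R f) = c * g a f"
  using linear[of a] by (simp_all add: linear_0 linear_add linear_diff linear_scale)

lemma subspace_Z: "subspace Z"
  unfolding subspace_def
proof (intro conjI ballI allI)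
  show "0 \<in> Z" unfolding zero_prod_def by (rule ZI) (auto simp: g_linear_simps)
next
  fix p q assume "p \<in> Z" "q \<in> Z"
  then obtain y f y' f' where pq: "p = (y, f)" "q = (y', f')" "(y, f) \<in> Z" "(y', f') \<in> Z"
    by (cases p, cases q) auto
  have "(y + y', f + f') \<in> Z"
  proof (rule ZI)
    fix a and e :: real assume e: "e > 0"
    show "finite {k \<in> A a. e \<le> \<bar>apply_bcontfun (y + y') k - g a (f + f')\<bar>}"
      using finite_UnI[OF ZD1[OF pq(3) half_gt_zero[OF e], of a] ZD1[OF pq(4) half_gt_zero[OF e], of a]]
      by (rule rev_finite_subset) (auto simp: g_linear_simps abs_if split: if_splits)
  next
    fix e :: real assume "e > 0"
    then obtain G G' where "finite G" "finite G'"
      and fin: "finite {k. k \<notin> \<Union>(A ` G) \<and> e/2 \<le> \<bar>apply_bcontfun y k\<bar>}"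
        "finite {k. k \<notin> \<Union>(A ` G') \<and> e/2 \<le> \<bar>apply_bcontfun y' k\<bar>}"
      using ZD2[OF pq(3), of "e/2"] ZD2[OF pq(4), of "e/2"] by auto
    moreover have "finite {k. k \<notin> \<Union>(A ` (G \<union> G')) \<and> e \<le> \<bar>apply_bcontfun (y + y') k\<bar>}"
      using finite_UnI[OF fin] by (rule rev_finite_subset) auto
    ultimately show "\<exists>G. finite G \<and> finite {k. k \<notin> \<Union>(A ` G) \<and> e \<le> \<bar>apply_bcontfun (y + y') k\<bar>}"
      by (intro exI[of _ "G \<union> G'"]) auto
  qed
  then show "p + q \<in> Z" by (simp add: pq)
next
  fix p c assume "p \<in> Z"
  then obtain y f where p: "p = (y, f)" "(y, f) \<in> Z" by (cases p) auto
  \<comment> \<open>The added 1 treats \<open>c = 0\<close> together with the other scalars.\<close>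
  have small: "e / (\<bar>c\<bar> + 1) \<le> \<bar>t\<bar>" if "e > 0" "e \<le> \<bar>c * t\<bar>" for e t :: real
  proof -
    have "e \<le> \<bar>t\<bar> * (\<bar>c\<bar> + 1)" using that by (simp add: abs_mult algebra_simps)
    then show ?thesis by (simp add: pos_divide_le_eq add_nonneg_pos)
  qed
  have pos: "e / (\<bar>c\<bar> + 1) > 0" if "e > 0" for e :: real using that by (simp add: add_nonneg_pos)
  have "(c *\<^sub>R y, c *\<^sub>R f) \<in> Z"
  proof (rule ZI)
    fix a and e :: real assume e: "e > 0"
    show "finite {k \<in> A a. e \<le> \<bar>apply_bcontfun (c *\<^sub>R y) k - g a (c *\<^sub>R f)\<bar>}"
      using ZD1[OF p(2) pos[OF e], of a]
      by (rule rev_finite_subset) (auto simp: g_linear_simps right_diff_distrib[symmetric] intro!: small e)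
  next
    fix e :: real assume e: "e > 0"
    then obtain G where "finite G"
      and fin: "finite {k. k \<notin> \<Union>(A ` G) \<and> e / (\<bar>c\<bar> + 1) \<le> \<bar>apply_bcontfun y k\<bar>}"
      using ZD2[OF p(2) pos[OF e]] by auto
    moreover have "finite {k. k \<notin> \<Union>(A ` G) \<and> e \<le> \<bar>apply_bcontfun (c *\<^sub>R y) k\<bar>}"
      using fin by (rule rev_finite_subset) (auto intro!: small e)
    ultimately show "\<exists>G. finite G \<and> finite {k. k \<notin> \<Union>(A ` G) \<and> e \<le> \<bar>apply_bcontfun (c *\<^sub>R y) k\<bar>}"
      by blast
  qed
  then show "c *\<^sub>R p \<in> Z" by (simp add: p)
qed

text \<open>Both defining conditions survive uniform perturbation. The bound \<open>D\<close> does
  not depend on \<open>a\<close>, so one element of \<open>Z\<close> near the limit approximates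
  \<open>y\<close> at all integers and \<open>g a f\<close> for all \<open>a\<close> at
  once.\<close>

lemma closed_Z: "closed Z"
  unfolding closed_sequential_limits
proof (intro allI impI, elim conjE)
  fix s z assume sZ: "\<forall>n. s n \<in> Z" and lim: "s \<longlonglongrightarrow> z"
  obtain y f where z: "z = (y, f)" by (cases z)
  have approx: "\<exists>u h. (u, h) \<in> Z \<and> (\<forall>k. \<bar>apply_bcontfun u k - apply_bcontfun y k\<bar> < e)
      \<and> (\<forall>a. \<bar>g a h - g a f\<bar> < e)" if e: "e > 0" for e
  proof -
    define d where "d = min e (e / (\<bar>D\<bar> + 1))"
    have "d > 0" using e by (simp add: d_def add_nonneg_pos)
    then obtain n where n: "dist (s n) z < d"
      using lim unfolding LIMSEQ_iff_nz dist_norm by blast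
    obtain u h where uh: "s n = (u, h)" by (cases "s n")
    have "norm (u - y) \<le> norm (s n - z)" "norm (h - f) \<le> norm (s n - z)"
      unfolding uh z diff_Pair by (rule norm_fst_le norm_snd_le)+
    then have d: "norm (u - y) < d" "norm (h - f) < d" using n by (auto simp: dist_norm)
    have "\<bar>apply_bcontfun u k - apply_bcontfun y k\<bar> < e" for k
      using abs_apply_le_norm[of "u - y" k] d(1) by (simp add: d_def)
    moreover have "\<bar>g a h - g a f\<bar> < e" for a
    proof -
      have "\<bar>g a h - g a f\<bar> \<le> D * norm (h - f)" using bounded[of a "h - f"] by (simp add: g_linear_simps)
      also have "\<dots> \<le> (\<bar>D\<bar> + 1) * norm (h - f)" by (intro mult_right_mono) auto
      also have "\<dots> < (\<bar>D\<bar> + 1) * (e / (\<bar>D\<bar> + 1))"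
        using d(2) by (intro mult_strict_left_mono) (auto simp: d_def add_nonneg_pos)
      also have "\<dots> = e" using e by (simp add: add_nonneg_eq_0_iff)
      finally show ?thesis .
    qed
    ultimately show ?thesis using sZ uh by metis
  qed
  have "(y, f) \<in> Z"
  proof (rule ZI)
    fix a and e :: real assume e: "e > 0"
    then have e3: "e/3 > 0" by simp
    obtain u h where uh: "(u, h) \<in> Z" "\<And>k. \<bar>apply_bcontfun u k - apply_bcontfun y k\<bar> < e/3"
       "\<And>a. \<bar>g a h - g a f\<bar> < e/3" using approx[OF e3] by blast
    show "finite {k \<in> A a. e \<le> \<bar>apply_bcontfun y k - g a f\<bar>}"
      using ZD1[OF uh(1) e3, of a]
    proof (rule rev_finite_subset, intro subsetI CollectI)
      fix k assume "k \<in> {k \<in> A a. e \<le> \<bar>apply_bcontfun y k - g a f\<bar>}"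
      then show "k \<in> A a \<and> e/3 \<le> \<bar>apply_bcontfun u k - g a h\<bar>"
        using uh(2)[of k] uh(3)[of a] by (auto simp: abs_if split: if_splits)
    qed
  next
    fix e :: real assume e: "e > 0"
    then have e2: "e/2 > 0" by simp
    obtain u h where uh: "(u, h) \<in> Z" "\<And>k. \<bar>apply_bcontfun u k - apply_bcontfun y k\<bar> < e/2"
      using approx[OF e2] by blast
    obtain G where "finite G" and
      fin: "finite {k. k \<notin> \<Union>(A ` G) \<and> e/2 \<le> \<bar>apply_bcontfun u k\<bar>}" using ZD2[OF uh(1) e2] by blast
    moreover have "finite {k. k \<notin> \<Union>(A ` G) \<and> e \<le> \<bar>apply_bcontfun y k\<bar>}"
      using fin
    proof (rule rev_finite_subset, intro subsetI CollectI)
      fix k assume "k \<in> {k. k \<notin> \<Union>(A ` G) \<and> e \<le> \<bar>apply_bcontfun y k\<bar>}"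
      then show "k \<notin> \<Union>(A ` G) \<and> e/2 \<le> \<bar>apply_bcontfun u k\<bar>"
        using uh(2)[of k] by (auto simp: abs_if split: if_splits)
    qed
    ultimately show "\<exists>G. finite G \<and> finite {k. k \<notin> \<Union>(A ` G) \<and> e \<le> \<bar>apply_bcontfun y k\<bar>}"
      by blast
  qed
  then show "z \<in> Z" by (simp add: z)
qed

text \<open>When \<open>f = 0\<close>, a member \<open>y\<close> tends to 0 along each of the
  finitely many sets \<open>A a\<close> with \<open>a\<close> in \<open>G\<close>, and is small at
  almost all integers outside of them.\<close>

lemma Z_zero_iff: "(y, 0) \<in> Z \<longleftrightarrow> y \<in> c0"
proof
  assume Z: "(y, 0) \<in> Z"
  show "y \<in> c0" unfolding c0_iff
  proof (intro allI impI)
    fix e :: real assume e: "e > 0"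
    obtain G where G: "finite G" "finite {k. k \<notin> \<Union>(A ` G) \<and> e \<le> \<bar>apply_bcontfun y k\<bar>}"
      using ZD2[OF Z e] by blast
    have "finite (\<Union>a\<in>G. {k \<in> A a. e \<le> \<bar>apply_bcontfun y k\<bar>})"
      using G(1) ZD1[OF Z e] by (auto simp: g_linear_simps)
    from finite_UnI[OF this G(2)] show "finite {k. e \<le> \<bar>apply_bcontfun y k\<bar>}"
      by (rule rev_finite_subset) auto
  qed
next
  assume "y \<in> c0"
  then have *: "finite {k. e \<le> \<bar>apply_bcontfun y k\<bar>}" if "e > 0" for e using that by (simp add: c0_iff)
  show "(y, 0) \<in> Z"
    by (rule ZI) (auto simp: g_linear_simps intro: rev_finite_subset[OF *] intro!: exI[of _ "{}"] *)
qed

text \<open>Only countably many \<open>g a f\<close> are nonzero. Removing from each of these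
  \<open>A a\<close> the earlier ones makes them disjoint and costs finitely many points, so
  \<open>y\<close> may be taken constantly equal to \<open>g a f\<close> on what remains. On any
  other \<open>A a\<close>, only the finitely many coefficients of size at least \<open>e\<close>
  can cause an error of that size.\<close>

lemma Z_surj: "\<exists>y. (y, f) \<in> Z"
proof -
  define C where "C = {a. g a f \<noteq> 0}"
  have "C \<subseteq> (\<Union>n. {a. inverse (real (Suc n)) \<le> \<bar>g a f\<bar>})"
  proof
    fix a assume "a \<in> C"
    then obtain n where "inverse (real (Suc n)) < \<bar>g a f\<bar>"
      using reals_Archimedean[of "\<bar>g a f\<bar>"] by (auto simp: C_def)
    then show "a \<in> (\<Union>n. {a. inverse (real (Suc n)) \<le> \<bar>g a f\<bar>})" by (auto intro: less_imp_le)
  qed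
  moreover have "countable (\<Union>n. {a. inverse (real (Suc n)) \<le> \<bar>g a f\<bar>})"
    by (rule countable_UN) (auto intro!: countable_finite vanishing)
  ultimately have cC: "countable C" by (rule countable_subset)
  define Q where "Q k m \<longleftrightarrow> (\<exists>a\<in>C. to_nat_on C a = m \<and> k \<in> A a)" for k m
  \<comment> \<open>disjointifies the countably many \<open>A a\<close> that matter: \<open>k\<close> is given to the first of them containing it\<close>
  define own where "own k = from_nat_into C (LEAST m. Q k m)" for k
  have own: "own k \<in> C \<and> k \<in> A (own k) \<and> (\<forall>a\<in>C. k \<in> A a \<longrightarrow> to_nat_on C (own k) \<le> to_nat_on C a)"
    if "\<exists>a\<in>C. k \<in> A a" for k
  proof -
    have "\<exists>m. Q k m" using that by (auto simp: Q_def)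
    then have "Q k (LEAST m. Q k m)" by (rule LeastI_ex)
    then obtain b where b: "b \<in> C" "to_nat_on C b = (LEAST m. Q k m)" "k \<in> A b" by (auto simp: Q_def)
    then have ob: "own k = b" using cC by (metis own_def from_nat_into_to_nat_on)
    have "to_nat_on C b \<le> to_nat_on C a" if "a \<in> C" "k \<in> A a" for a
      unfolding b by (rule Least_le) (use that in \<open>auto simp: Q_def\<close>)
    then show ?thesis using ob b by auto
  qed
  define yf where "yf k = (if \<exists>a\<in>C. k \<in> A a then g (own k) f else 0)" for k
  have Dn: "0 \<le> D * norm f" using bounded[of undefined f] by linarith
  have "yf \<in> bcontfun"
    by (rule bcontfun_normI[where b = "D * norm f"]) (auto simp: yf_def Dn bounded)
  then obtain y where y: "apply_bcontfun y k = yf k" for k by (metis Bcontfun_inverse)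
  have big: "own k \<in> C \<and> k \<in> A (own k) \<and> e \<le> \<bar>g (own k) f\<bar>" if "e > 0" "e \<le> \<bar>yf k\<bar>" for e k
    using that own[of k] by (auto simp: yf_def split: if_splits)
  have "(y, f) \<in> Z"
  proof (rule ZI)
    fix a and e :: real assume e: "e > 0"
    show "finite {k \<in> A a. e \<le> \<bar>apply_bcontfun y k - g a f\<bar>}"
    proof (cases "a \<in> C")
      case True
      have "finite {b \<in> C. to_nat_on C b < to_nat_on C a}"
        by (rule inj_on_finite[where f = "to_nat_on C" and B = "{..<to_nat_on C a}"])
          (use cC in \<open>auto intro: inj_on_subset[OF inj_on_to_nat_on]\<close>)
      then have "finite (\<Union>b\<in>{b \<in> C. to_nat_on C b < to_nat_on C a}. A b \<inter> A a)"
        by (rule finite_UN_I) (auto intro!: almost_disjoint)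
      then show ?thesis
      proof (rule rev_finite_subset, intro subsetI)
        fix k assume "k \<in> {k \<in> A a. e \<le> \<bar>apply_bcontfun y k - g a f\<bar>}"
        then have k: "k \<in> A a" "e \<le> \<bar>yf k - g a f\<bar>" by (auto simp: y)
        then have o: "own k \<in> C" "k \<in> A (own k)" "to_nat_on C (own k) \<le> to_nat_on C a"
          using own[of k] True by blast+
        have "yf k = g (own k) f" using k True by (auto simp: yf_def)
        then have "own k \<noteq> a" using k e by auto
        then have "to_nat_on C (own k) \<noteq> to_nat_on C a"
          using o(1) True cC by (metis from_nat_into_to_nat_on)
        then show "k \<in> (\<Union>b\<in>{b \<in> C. to_nat_on C b < to_nat_on C a}. A b \<inter> A a)"
          using o k by auto
      qed
    next
      case False
      then have ga: "g a f = 0" by (simp add: C_def)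
      have "finite {b \<in> C. e \<le> \<bar>g b f\<bar>}"
        using vanishing[OF e, of f] by (rule rev_finite_subset) auto
      then have "finite (\<Union>b\<in>{b \<in> C. e \<le> \<bar>g b f\<bar>}. A b \<inter> A a)"
        by (rule finite_UN_I) (use False in \<open>auto intro!: almost_disjoint\<close>)
      then show ?thesis
        by (rule rev_finite_subset) (use big[OF e] in \<open>auto simp: y ga\<close>)
    qed
  next
    fix e :: real assume e: "e > 0"
    have "{k. k \<notin> \<Union>(A ` {a. e \<le> \<bar>g a f\<bar>}) \<and> e \<le> \<bar>apply_bcontfun y k\<bar>} = {}"
      using big[OF e] by (auto simp: y)
    then show "\<exists>G. finite G \<and> finite {k. k \<notin> \<Union>(A ` G) \<and> e \<le> \<bar>apply_bcontfun y k\<bar>}"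
      using vanishing[OF e, of f] by (metis finite.emptyI)
  qed
  then show ?thesis ..
qed

lemma twisted_sum_Z: "twisted_sum c0 norm UNIV norm Z norm (\<lambda>y. (y, 0)) snd"
proof -
  have "banach_on Z norm"
    unfolding banach_on_def normed_on_def
  proof (intro conjI ballI allI impI)
    fix s :: "nat \<Rightarrow> (nat \<Rightarrow>\<^sub>C real) \<times> 'x"
    assume s: "(\<forall>n. s n \<in> Z) \<and> (\<forall>e>0. \<exists>M. \<forall>m\<ge>M. \<forall>n\<ge>M. norm (s m - s n) < e)"
    then have "Cauchy s" by (simp add: Cauchy_iff)
    then have "Cauchy (\<lambda>n. fst (s n))" "Cauchy (\<lambda>n. snd (s n))" by (rule Cauchy_fst Cauchy_snd)+
    then obtain y f where "(\<lambda>n. fst (s n)) \<longlonglongrightarrow> y" "(\<lambda>n. snd (s n)) \<longlonglongrightarrow> f"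
      using complete complete_UNIV_bcontfun unfolding complete_def by blast
    from tendsto_Pair[OF this] obtain z where z: "s \<longlonglongrightarrow> z" by auto
    have "z \<in> Z" using closed_sequentially[OF closed_Z _ z] s by blast
    moreover have "(\<lambda>n. norm (s n - z)) \<longlonglongrightarrow> 0" using z by (simp add: LIM_zero tendsto_norm_zero)
    ultimately show "\<exists>z\<in>Z. (\<lambda>n. norm (s n - z)) \<longlonglongrightarrow> 0" by blast
  qed (auto simp: subspace_Z norm_triangle_ineq)
  moreover have "bounded_linear_between c0 norm Z norm (\<lambda>y. (y, 0))"
    unfolding bounded_linear_between_def
    by (auto simp: Z_zero_iff norm_Pair intro!: exI[of _ 1])
  moreover have "bounded_linear_between Z norm UNIV norm snd"
    unfolding bounded_linear_between_def by (auto intro!: exI[of _ 1] norm_snd_le)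
  moreover have "snd ` Z = UNIV" using Z_surj by force
  moreover have "(\<lambda>y. (y, 0)) ` c0 = {z \<in> Z. snd z = 0}"
    by (auto simp: Z_zero_iff image_iff)
  ultimately show ?thesis by (auto simp: twisted_sum_def inj_on_def)
qed

text \<open>A complement \<open>W\<close> of the kernel of \<open>snd\<close> meets every fibre of
  \<open>snd\<close> in exactly one point, so it is the graph of a linear map \<open>S\<close>.
  Since \<open>W\<close> is closed in \<open>Z\<close> and \<open>Z\<close> is closed, the closed
  graph theorem bounds \<open>S\<close>.\<close>

lemma bounded_lifting:
  assumes "complemented_in ((\<lambda>y. (y, 0)) ` c0) Z norm"
  obtains S C where "linear S" "\<And>f. norm (S f) \<le> C * norm f" "\<And>f. (S f, f) \<in> Z"
proof -
  obtain W where W: "subspace W" "W \<subseteq> Z"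
    and Wcl: "\<And>s z. (\<And>n. s n \<in> W) \<Longrightarrow> z \<in> Z \<Longrightarrow> (\<lambda>n. norm (s n - z)) \<longlonglongrightarrow> 0 \<Longrightarrow> z \<in> W"
    and W0: "(\<lambda>y. (y, 0)) ` c0 \<inter> W = {0}"
    and WZ: "{m + w | m w. m \<in> (\<lambda>y. (y, 0)) ` c0 \<and> w \<in> W} = Z"
    using assms unfolding complemented_in_def by (elim exE conjE) blast
  have ex: "\<exists>y. (y, f) \<in> W" for f
  proof -
    obtain y where "(y, f) \<in> Z" using Z_surj by blast
    then obtain u w where uw: "(y, f) = (u, 0) + w" "w \<in> W" unfolding WZ[symmetric] by blast
    then have "w = (fst w, f)" by (cases w) auto
    then show ?thesis using uw(2) by metis
  qed
  have uniq: "y = y'" if "(y, f) \<in> W" "(y', f) \<in> W" for y y' f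
  proof -
    have "(y - y', 0) \<in> W" using subspace_diff[OF W(1) that] by simp
    moreover from this have "y - y' \<in> c0" using W(2) Z_zero_iff by blast
    ultimately have "(y - y', 0) \<in> (\<lambda>y. (y, 0)) ` c0 \<inter> W" by blast
    then show ?thesis unfolding W0 by (simp add: zero_prod_def)
  qed
  define S where "S f = (THE y. (y, f) \<in> W)" for f
  have S: "(S f, f) \<in> W" for f
    unfolding S_def using ex uniq by (metis theI)
  have SI: "y = S f" if "(y, f) \<in> W" for y f by (rule uniq[OF that S])
  have lin: "linear S"
  proof (rule linearI)
    show "S (f + h) = S f + S h" for f h
      using subspace_add[OF W(1) S[of f] S[of h]] by (auto intro: SI[symmetric])
    show "S (c *\<^sub>R f) = c *\<^sub>R S f" for c f
      using subspace_scale[OF W(1) S[of f], of c] by (auto intro: SI[symmetric])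
  qed
  have graph: "y = S x" if "s \<longlonglongrightarrow> x" "(\<lambda>n. S (s n)) \<longlonglongrightarrow> y" for s x y
  proof (rule SI)
    have lim: "(\<lambda>n. (S (s n), s n)) \<longlonglongrightarrow> (y, x)" using that by (intro tendsto_Pair)
    have "(y, x) \<in> Z" using closed_sequentially[OF closed_Z _ lim] S W(2) by blast
    then show "(y, x) \<in> W"
      using Wcl[of "\<lambda>n. (S (s n), s n)"] S tendsto_norm_zero[OF LIM_zero[OF lim]] by blast
  qed
  obtain C where "\<And>f. norm (S f) \<le> C * norm f"
    by (rule closed_graph_imp_bounded[OF complete complete_UNIV_bcontfun lin graph]) auto
  then show ?thesis using that lin S W(2) by blast
qed

end

subsection \<open>Diagonalization under CH\<close>

text \<open>Sequences of sets of integers are as many as the reals. In a well-order of least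
  possible type every proper initial segment has smaller cardinality than the whole, and under
  \<open>CH\<close> such a segment is countable.\<close>

lemma CH_wellorder:
  assumes CH
  obtains r :: "((nat \<Rightarrow> nat set) \<times> (nat \<Rightarrow> nat set)) set"
  where "wf r" "\<And>a b. a \<noteq> b \<Longrightarrow> (a, b) \<in> r \<or> (b, a) \<in> r" "\<And>a. countable {b. (b, a) \<in> r}"
proof -
  define r where "r = card_of (UNIV :: (nat \<Rightarrow> nat set) set)"
  have wo: "well_order_on UNIV r" unfolding r_def by (rule card_of_well_order_on)
  have inj: "inj (\<lambda>f. {prod_encode (n, k) | n k. k \<in> f n})"
  proof (rule injI)
    fix f h :: "nat \<Rightarrow> nat set"
    assume "{prod_encode (n, k) | n k. k \<in> f n} = {prod_encode (n, k) | n k. k \<in> h n}"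
    then have "k \<in> f n \<longleftrightarrow> k \<in> h n" for n k
      by (auto simp: set_eq_iff dest: spec[of _ "prod_encode (n, k)"])
    then show "f = h" by blast
  qed
  obtain e0 :: "nat set \<Rightarrow> real" where "bij_betw e0 UNIV UNIV"
    using nat_sets_eqpoll_reals by (auto simp: eqpoll_def)
  then have e0: "inj e0" by (simp add: bij_betw_def)
  obtain e :: "(nat \<Rightarrow> nat set) \<Rightarrow> real" where e: "inj e"
    using inj_compose[OF e0 inj] by blast
  have "countable {b. (b, a) \<in> r - Id}" for a
  proof (rule ccontr)
    define U where "U = Order_Relation.underS r a"
    have U: "U = {b. (b, a) \<in> r - Id}" by (auto simp: U_def Order_Relation.underS_def)
    assume "\<not> ?thesis"
    then have un: "uncountable U" by (simp add: U)
    have "a \<in> Field r" by (simp add: r_def Field_card_of)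
    then have less: "(card_of U, card_of (UNIV :: (nat \<Rightarrow> nat set) set)) \<in> ordLess"
      using card_of_underS[of r a] unfolding U_def r_def by (simp add: card_of_Card_order)
    have une: "uncountable (e ` U)"
      using un countable_image_inj_on[of e U] inj_on_subset[OF e subset_UNIV] by blast
    then have "infinite (e ` U)" using countable_finite by blast
    moreover have "\<not> e ` U \<approx> (UNIV :: nat set)"
      using une by (auto simp: eqpoll_def bij_betw_def intro: countableI)
    ultimately have "e ` U \<approx> (UNIV :: real set)"
      using \<open>CH\<close> unfolding CH_def by blast
    then obtain h where "bij_betw h (UNIV :: real set) (e ` U)"
      using eqpoll_sym unfolding eqpoll_def by blast
    then have h: "inj h" "range h = e ` U" by (auto simp: bij_betw_def)
    \<comment> \<open>An uncountable segment \<open>U\<close> has an image equipollent to the reals,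
      so the whole type would embed into \<open>U\<close>, against the minimality of the order
      type.\<close>
    have "inj (\<lambda>x. inv_into U e (h (e x)))"
    proof (rule injI)
      fix x y assume "inv_into U e (h (e x)) = inv_into U e (h (e y))"
      then have "h (e x) = h (e y)" using h(2) by (metis f_inv_into_f rangeI)
      then show "x = y" using h(1) e by (simp add: inj_eq)
    qed
    moreover have "range (\<lambda>x. inv_into U e (h (e x))) \<subseteq> U"
      using h(2) by (metis image_subsetI inv_into_into rangeI)
    ultimately have "(card_of (UNIV :: (nat \<Rightarrow> nat set) set), card_of U) \<in> ordLeq"
      using card_of_ordLeq[of UNIV U] by blast
    then show False using less not_ordLess_ordLeq by blast
  qed
  moreover have "wf (r - Id)" using wo by (simp add: well_order_on_def)
  moreover have "(a, b) \<in> r - Id \<or> (b, a) \<in> r - Id" if "a \<noteq> b" for a b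
    using wo that by (auto simp: well_order_on_def linear_order_on_def total_on_def)
  ultimately show ?thesis by (intro that[of "r - Id"]) auto
qed

text \<open>Choose increasing points of \<open>Y\<close>, the \<open>n\<close>-th one outside
  \<open>a i\<close> for all \<open>i < n\<close>. Then \<open>a i\<close> can contain only the
  points numbered 0 to \<open>i\<close>.\<close>

lemma infinite_almost_disjoint_subset:
  fixes Y :: "nat set" and a :: "nat \<Rightarrow> nat set"
  assumes "\<And>N. infinite (Y - (\<Union>i<N. a i))"
  obtains X where "X \<subseteq> Y" "infinite X" "\<And>i. finite (X \<inter> a i)"
proof -
  have "\<exists>f. \<forall>n. f n \<in> Y - (\<Union>i<n. a i) \<and> f n < f (Suc n)"
  proof (rule dependent_nat_choice)
    show "\<exists>x. x \<in> Y - (\<Union>i<0. a i)" using assms[of 0] by (metis finite.emptyI ex_in_conv)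
  next
    fix x n
    show "\<exists>y. y \<in> Y - (\<Union>i<Suc n. a i) \<and> x < y"
      using assms[of "Suc n"] by (meson infinite_nat_iff_unbounded)
  qed
  then obtain f where f: "\<And>n. f n \<in> Y - (\<Union>i<n. a i)" "\<And>n. f n < f (Suc n)" by blast
  have "strict_mono f" using f(2) by (simp add: strict_mono_Suc_iff)
  then have "infinite (range f)" by (simp add: range_inj_infinite strict_mono_imp_inj_on)
  moreover have "finite (range f \<inter> a i)" for i
  proof -
    have "range f \<inter> a i \<subseteq> f ` {..i}"
    proof
      fix k assume "k \<in> range f \<inter> a i"
      then obtain n where "k = f n" "f n \<in> a i" by blast
      moreover from this have "\<not> i < n" using f(1)[of n] by blast
      ultimately show "k \<in> f ` {..i}" by auto
    qed
    then show ?thesis by (rule finite_subset) simp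
  qed
  ultimately show ?thesis using that[of "range f"] f(1) by blast
qed

text \<open>Equivalently, the indicators of the sets \<open>B n\<close> have sum at most
  \<open>M\<close> everywhere. Quantifying over finite \<open>F\<close> also excludes points in
  infinitely many \<open>B n\<close>, for which \<open>card\<close> of the full index set would be
  0.\<close>

definition bounded_overlap :: "nat \<Rightarrow> (nat \<Rightarrow> 'b set) \<Rightarrow> bool" where
  "bounded_overlap M B \<longleftrightarrow> (\<forall>k F. finite F \<and> (\<forall>n\<in>F. k \<in> B n) \<longrightarrow> card F \<le> M)"

text \<open>If the overlap is at most \<open>M\<close>, no point lies in all of the
  \<open>M + 1\<close> sets \<open>B 0\<close> to \<open>B M\<close>, so their complements cover the
  integers. Hence one complement is not almost covered by finitely many \<open>a i\<close>, and
  \<open>X\<close> can be found inside it. Without bounded overlap the last condition is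
  vacuous.\<close>

lemma diagonal_step:
  fixes B :: "nat \<Rightarrow> nat set" and a :: "nat \<Rightarrow> nat set"
  assumes inf: "\<And>N. infinite (- (\<Union>i<N. a i))"
  shows "\<exists>X n. infinite X \<and> (\<forall>i. finite (X \<inter> a i)) \<and> (\<forall>M. bounded_overlap M B \<longrightarrow> X \<inter> B n = {})"
proof -
  have "\<exists>Y n. (\<forall>N. infinite (Y - (\<Union>i<N. a i))) \<and> (\<forall>M. bounded_overlap M B \<longrightarrow> Y \<inter> B n = {})"
  proof (cases "\<exists>M. bounded_overlap M B")
    case False
    then show ?thesis using inf by (intro exI[of _ UNIV]) (auto simp: Compl_eq_Diff_UNIV)
  next
    case True
    then obtain M where M: "bounded_overlap M B" ..
    have "\<exists>n. \<forall>N. infinite (- B n - (\<Union>i<N. a i))"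
    proof (rule ccontr)
      assume "\<not> ?thesis"
      then obtain N where N: "\<And>n. finite (- B n - (\<Union>i<N n. a i))" by metis
      define L where "L = Max (N ` {..M})"
      have "- (\<Union>i<L. a i) \<subseteq> (\<Union>n\<le>M. - B n - (\<Union>i<N n. a i))"
      proof
        fix k assume k: "k \<in> - (\<Union>i<L. a i)"
        have "\<exists>n\<le>M. k \<notin> B n"
          using M[unfolded bounded_overlap_def, rule_format, of "{..M}" k] by auto
        then obtain n where n: "n \<le> M" "k \<notin> B n" by blast
        then have "N n \<le> L" by (simp add: L_def)
        then show "k \<in> (\<Union>n\<le>M. - B n - (\<Union>i<N n. a i))" using k n by force
      qed
      then show False using inf[of L] N by (meson finite_UN finite_atMost finite_subset)
    qed
    then obtain n where n: "\<forall>N. infinite (- B n - (\<Union>i<N. a i))" ..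
    then show ?thesis by (intro exI[of _ "- B n"] exI[of _ n]) simp
  qed
  then obtain Y n where Y: "\<And>N. infinite (Y - (\<Union>i<N. a i))"
    "\<And>M. bounded_overlap M B \<Longrightarrow> Y \<inter> B n = {}" by blast
  obtain X where "X \<subseteq> Y" "infinite X" "\<And>i. finite (X \<inter> a i)"
    by (rule infinite_almost_disjoint_subset[of Y a]) (use Y(1) in auto)
  then show ?thesis using Y(2) by blast
qed

text \<open>Recursion along \<open>r\<close>: at stage \<open>B\<close> only countably many sets
  have been chosen, so together with the columns they can be enumerated as a sequence
  \<open>a\<close> and \<open>diagonal_step\<close> applies.\<close>

lemma diagonalizing_almost_disjoint_family:
  fixes r :: "((nat \<Rightarrow> nat set) \<times> (nat \<Rightarrow> nat set)) set"
  assumes "wf r" and total: "\<And>a b. a \<noteq> b \<Longrightarrow> (a, b) \<in> r \<or> (b, a) \<in> r"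
    and count: "\<And>a. countable {b. (b, a) \<in> r}"
  obtains A :: "(nat \<Rightarrow> nat set) \<Rightarrow> nat set" and \<nu> :: "(nat \<Rightarrow> nat set) \<Rightarrow> nat"
  where "\<And>B. infinite (A B)" "\<And>B B'. B \<noteq> B' \<Longrightarrow> finite (A B \<inter> A B')"
    "\<And>B M. bounded_overlap M B \<Longrightarrow> A B \<inter> B (\<nu> B) = {}"
proof -
  \<comment> \<open>Keeping the family almost disjoint from the columns ensures that finitely many of its
    members never cover almost all of the integers.\<close>
  define col where "col j = range (\<lambda>k. prod_encode (j, k))" for j :: nat
  have col: "infinite (col j)" "i \<noteq> j \<Longrightarrow> col i \<inter> col j = {}" for i j
    by (auto simp: col_def inj_on_def intro!: range_inj_infinite)
  define P :: "((nat \<Rightarrow> nat set) \<Rightarrow> nat set \<times> nat) \<Rightarrow> (nat \<Rightarrow> nat set) \<Rightarrow> nat set \<times> nat \<Rightarrow> bool"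
    where "P f B y \<longleftrightarrow> infinite (fst y) \<and> (\<forall>j. finite (fst y \<inter> col j))
      \<and> (\<forall>B'. (B', B) \<in> r \<longrightarrow> finite (fst y \<inter> fst (f B')))
      \<and> (\<forall>M. bounded_overlap M B \<longrightarrow> fst y \<inter> B (snd y) = {})" for f B y
  have "\<exists>f. \<forall>B. P f B (f B)"
  proof (rule dependent_wf_choice[OF \<open>wf r\<close>])
    show "P f B y = P g B y" if "\<And>z. (z, B) \<in> r \<Longrightarrow> f z = g z" for f g B y
      using that by (auto simp: P_def)
  next
    fix B f assume prev: "\<And>B'. (B', B) \<in> r \<Longrightarrow> P f B' (f B')"
    define \<A> where "\<A> = range col \<union> (\<lambda>B'. fst (f B')) ` {B'. (B', B) \<in> r}"
    define a where "a = from_nat_into \<A>"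
    have ra: "range a = \<A>"
      unfolding a_def using count[of B] by (intro range_from_nat_into) (auto simp: \<A>_def)
    have fin: "finite (X \<inter> col j)" if "X \<in> \<A>" "X \<noteq> col j" for X j
    proof (cases "X \<in> range col")
      case True
      then show ?thesis using that(2) col(2) by (metis finite.emptyI rangeE)
    next
      case False
      then show ?thesis using that(1) prev by (auto simp: \<A>_def P_def)
    qed
    have "infinite (- (\<Union>i<N. a i))" for N
    proof
      assume *: "finite (- (\<Union>i<N. a i))"
      have "inj col" using col by (intro injI) (metis Int_absorb finite.emptyI)
      then have "infinite (range col)" by (rule range_inj_infinite)
      \<comment> \<open>A column that is not among the first \<open>N\<close> sets meets each of
        them in a finite set, so these sets cannot cover almost all of it.\<close>
      then obtain j where j: "col j \<notin> a ` {..<N}"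
        by (meson finite_imageI finite_lessThan finite_subset image_subsetI)
      have "finite (a i \<inter> col j)" if "i < N" for i using that j ra by (intro fin) auto
      then have "finite (\<Union>i<N. a i \<inter> col j)" by blast
      from finite_UnI[OF this *] have "finite (col j)" by (rule rev_finite_subset) auto
      then show False using col(1) by blast
    qed
    from diagonal_step[OF this, of B] obtain X n where
      "infinite X" "\<And>i. finite (X \<inter> a i)" "\<And>M. bounded_overlap M B \<Longrightarrow> X \<inter> B n = {}" by blast
    moreover from this(2) ra have "finite (X \<inter> C)" if "C \<in> \<A>" for C using that by blast
    ultimately have "P f B (X, n)" unfolding P_def by (auto simp: \<A>_def)
    then show "\<exists>y. P f B y" ..
  qed
  then obtain f where f: "\<And>B. P f B (f B)" by blast
  show ?thesis
  proof (rule that[of "\<lambda>B. fst (f B)" "\<lambda>B. snd (f B)"])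
    show "finite (fst (f B) \<inter> fst (f B'))" if "B \<noteq> B'" for B B'
      using total[OF that] f[of B] f[of B'] by (auto simp: P_def Int_commute)
  qed (use f in \<open>auto simp: P_def\<close>)
qed

subsection \<open>Truncations in Valdivia compacta\<close>

text \<open>\<open>cl\<close> closes a set of coordinates under the (countable) supports of chosen points of the dense
  \<open>\<Sigma>\<close>-subset approximating the points of \<open>Y\<close> on finite subsets; the truncation is then a cluster
  point of these approximations.\<close>

lemma truncation_hull:
  fixes \<phi> :: "'a::t2_space \<Rightarrow> ('i \<Rightarrow> real)"
  assumes compact: "compact (UNIV :: 'a set)" and cont: "continuous_on UNIV \<phi>"
    and dense: "closure (\<phi> -` Sigma_prod) = UNIV" and "countable Y"
  shows "\<exists>cl :: 'i set \<Rightarrow> 'i set. \<forall>S. S \<subseteq> cl S \<and> (countable S \<longrightarrow> countable (cl S))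
    \<and> (\<forall>y\<in>Y. \<exists>z. \<forall>i. \<phi> z i = (if i \<in> cl S then \<phi> y i else 0))"
proof -
  have coord: "continuous_on UNIV (\<lambda>y. \<phi> y i)" for i
    using cont by (rule continuous_on_product_then_coordinatewise)
  have ex: "\<exists>a. a \<in> \<phi> -` Sigma_prod \<and> (\<forall>i\<in>F. \<bar>\<phi> a i - \<phi> y i\<bar> \<le> 1 / real (Suc m))"
    if "finite F" for y F m
  proof -
    have "open {z. \<forall>i\<in>F. \<bar>\<phi> z i - \<phi> y i\<bar> < 1 / real (Suc m)}"
      unfolding Collect_ball_eq
      by (intro open_INT that ballI open_Collect_less continuous_intros coord)
    moreover have "y \<in> {z. \<forall>i\<in>F. \<bar>\<phi> z i - \<phi> y i\<bar> < 1 / real (Suc m)}" by simp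
    ultimately have "{z. \<forall>i\<in>F. \<bar>\<phi> z i - \<phi> y i\<bar> < 1 / real (Suc m)} \<inter> \<phi> -` Sigma_prod \<noteq> {}"
      using open_Int_closure_eq_empty[of _ "\<phi> -` Sigma_prod"] unfolding dense by blast
    then show ?thesis by (auto intro: less_imp_le)
  qed
  define a where "a y F m = (SOME a. a \<in> \<phi> -` Sigma_prod \<and>
    (\<forall>i\<in>F. \<bar>\<phi> a i - \<phi> y i\<bar> \<le> 1 / real (Suc m)))" for y F m
  have a: "a y F m \<in> \<phi> -` Sigma_prod"
    "i \<in> F \<Longrightarrow> \<bar>\<phi> (a y F m) i - \<phi> y i\<bar> \<le> 1 / real (Suc m)" if "finite F" for y F m i
    using someI_ex[OF ex[OF that, of y m]] unfolding a_def by blast+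
  define step where "step S = S \<union>
    (\<Union>y\<in>Y. \<Union>F\<in>{F. finite F \<and> F \<subseteq> S}. \<Union>m. {i. \<phi> (a y F m) i \<noteq> 0})" for S
  define cl where "cl S = (\<Union>n. (step ^^ n) S)" for S
  have step: "S \<subseteq> step S" for S by (auto simp: step_def)
  have cstep: "countable (step S)" if "countable S" for S
  proof -
    have "countable {i. \<phi> (a y F m) i \<noteq> 0}" if "finite F" for y F m
      using a(1)[OF that] by (simp add: Sigma_prod_def)
    then show ?thesis
      unfolding step_def using that \<open>countable Y\<close>
      by (intro countable_Un countable_UN) (auto simp: countable_Collect_finite_subset)
  qed
  have ccl: "countable (cl S)" if "countable S" for S
  proof -
    have "countable ((step ^^ n) S)" for n by (induction n) (auto simp: that cstep)
    then show ?thesis by (simp add: cl_def)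
  qed
  \<comment> \<open>A finite \<open>F\<close> inside \<open>cl S\<close> already lies in some stage
    \<open>N\<close> of the iteration, so the support of its approximant is added at stage
    \<open>N + 1\<close>.\<close>
  have closed: "\<phi> (a y F m) i = 0" if "y \<in> Y" "finite F" "F \<subseteq> cl S" "i \<notin> cl S" for y F m i S
  proof (rule ccontr)
    assume nz: "\<phi> (a y F m) i \<noteq> 0"
    have "\<forall>j\<in>F. \<exists>n. j \<in> (step ^^ n) S" using \<open>F \<subseteq> cl S\<close> unfolding cl_def by blast
    from bchoice[OF this] obtain n where n: "\<And>j. j \<in> F \<Longrightarrow> j \<in> (step ^^ n j) S" by blast
    define N where "N = Max (n ` F)"
    have mono: "(step ^^ k) S \<subseteq> (step ^^ l) S" if "k \<le> l" for k l
      using that by (induction rule: dec_induct) (use step in auto)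
    have "F \<subseteq> (step ^^ N) S"
    proof
      fix j assume "j \<in> F"
      then show "j \<in> (step ^^ N) S" using n[of j] mono[of "n j" N] \<open>finite F\<close> by (auto simp: N_def)
    qed
    then have "i \<in> step ((step ^^ N) S)" using nz that(1,2) unfolding step_def by blast
    then have "i \<in> (step ^^ Suc N) S" by simp
    then show False using that(4) unfolding cl_def by blast
  qed
  have trunc: "\<exists>z. \<forall>i. \<phi> z i = (if i \<in> cl S then \<phi> y i else 0)" if "y \<in> Y" for y S
  proof -
    define D where "D = (\<lambda>(i, m). if i \<in> cl S then {z. \<bar>\<phi> z i - \<phi> y i\<bar> \<le> 1 / real (Suc m)}
      else {z. \<phi> z i = 0})"
    \<comment> \<open>Finitely many of these closed conditions are met by one approximant
      \<open>a y F M\<close>, where \<open>F\<close> collects the coordinates concerned that lie in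
      \<open>cl S\<close> and \<open>M\<close> is the best accuracy demanded. Off
      \<open>cl S\<close> it vanishes by \<open>closed\<close>.\<close>
    have "UNIV \<inter> \<Inter>(D ` UNIV) \<noteq> {}"
    proof (rule compact_imp_fip_image[OF compact])
      fix im :: "'i \<times> nat"
      have "closed {z. \<bar>\<phi> z i - \<phi> y i\<bar> \<le> 1 / real (Suc m)}" "closed {z. \<phi> z i = 0}" for i m
        by (intro closed_Collect_le closed_Collect_eq continuous_intros coord)+
      then show "closed (D im)" by (auto simp: D_def split: prod.split)
    next
      fix I :: "('i \<times> nat) set" assume "finite I"
      define F where "F = fst ` I \<inter> cl S"
      define M where "M = Max (snd ` I)"
      have F: "finite F" "F \<subseteq> cl S" using \<open>finite I\<close> by (auto simp: F_def)
      have "a y F M \<in> D (i, m)" if im: "(i, m) \<in> I" for i m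
      proof (cases "i \<in> cl S")
        case True
        then have "i \<in> F" using im by (force simp: F_def)
        have "m \<le> M" using im \<open>finite I\<close> by (force simp: M_def intro!: Max_ge)
        then have "1 / real (Suc M) \<le> 1 / real (Suc m)" by (simp add: frac_le)
        then show ?thesis using True a(2)[OF F(1) \<open>i \<in> F\<close>, of y M] by (simp add: D_def)
      next
        case False
        then show ?thesis using closed[OF \<open>y \<in> Y\<close> F] by (simp add: D_def)
      qed
      then show "UNIV \<inter> \<Inter>(D ` I) \<noteq> {}" by (metis IntI INT_I UNIV_I empty_iff surj_pair)
    qed
    then obtain z where z: "z \<in> D (i, m)" for i m by blast
    have "\<phi> z i = (if i \<in> cl S then \<phi> y i else 0)" for i
    proof (cases "i \<in> cl S")
      case True
      have "\<bar>\<phi> z i - \<phi> y i\<bar> \<le> e" if "e > 0" for e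
      proof -
        obtain m where "inverse (real (Suc m)) < e" using reals_Archimedean[OF \<open>e > 0\<close>] by blast
        moreover have "\<bar>\<phi> z i - \<phi> y i\<bar> \<le> inverse (real (Suc m))"
          using z[of i m] True by (simp add: D_def inverse_eq_divide)
        ultimately show ?thesis by linarith
      qed
      then have "\<bar>\<phi> z i - \<phi> y i\<bar> \<le> 0" by (rule field_le_epsilon) simp
      then show ?thesis using True by simp
    next
      case False
      then show ?thesis using z[of i 0] by (simp add: D_def)
    qed
    then show ?thesis by blast
  qed
  have sub: "S \<subseteq> cl S" for S unfolding cl_def by (rule order_trans[OF _ UN_upper[of 0]]) simp_all
  show ?thesis by (intro exI[of _ cl] allI conjI impI ballI sub ccl trunc)
qed

text \<open>A single continuous function \<open>G\<close> is zero at \<open>x\<close>, positive at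
  every \<open>s n\<close>, and depends on countably many coordinates only. Along a subsequence on
  which \<open>G\<close> more than halves at each step, bumps around the values of \<open>G\<close>
  have disjoint supports.\<close>

lemma separated_subsequence:
  fixes \<phi> :: "'a::topological_space \<Rightarrow> ('i \<Rightarrow> real)"
  assumes cont: "continuous_on UNIV \<phi>" and "inj \<phi>" and lim: "s \<longlonglongrightarrow> x" and ne: "\<And>n. s n \<noteq> x"
  obtains \<sigma> :: "nat \<Rightarrow> nat" and J u where "strict_mono \<sigma>" "countable J"
    "\<And>n. continuous_on UNIV (u n)" "\<And>n y. 0 \<le> u n y" "\<And>n. 0 < u n (s (\<sigma> n))" "\<And>n. u n x = (0::real)"
    "\<And>m n y. m \<noteq> n \<Longrightarrow> u m y = 0 \<or> u n y = 0"
    "\<And>n y y'. (\<And>i. i \<in> J \<Longrightarrow> \<phi> y i = \<phi> y' i) \<Longrightarrow> u n y = u n y'"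
proof -
  have coord: "continuous_on UNIV (\<lambda>y. \<phi> y i)" for i
    using cont by (rule continuous_on_product_then_coordinatewise)
  have "\<exists>i. \<phi> (s n) i \<noteq> \<phi> x i" for n using ne[of n] \<open>inj \<phi>\<close> by (metis ext injD)
  then obtain j where j: "\<And>n. \<phi> (s n) (j n) \<noteq> \<phi> x (j n)" by metis
  define w where "w n y = (1/2) ^ n * min 1 \<bar>\<phi> y (j n) - \<phi> x (j n)\<bar>" for n y
  define G where "G y = (\<Sum>n. w n y)" for y
  have w0: "0 \<le> w n y" for n y by (simp add: w_def)
  have wle: "norm (w n y) \<le> (1/2) ^ n" for n y
    using w0[of n y] by (simp add: w_def mult_left_le)
  have sumw: "summable (\<lambda>n. w n y)" for y
    by (rule summable_comparison_test'[OF summable_geometric[of "1/2"]]) (auto intro: wle[simplified])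
  have "uniform_limit UNIV (\<lambda>N y. \<Sum>n<N. w n y) G sequentially"
    unfolding G_def by (rule Weierstrass_m_test[OF wle]) (auto intro: summable_geometric)
  then have contG: "continuous_on UNIV G"
    by (rule uniform_limit_theorem[rotated])
      (auto simp: w_def intro!: always_eventually continuous_intros coord)
  have Gx: "G x = 0" by (simp add: G_def w_def)
  have Gpos: "0 < G (s n)" for n
  proof -
    have "0 < w n (s n)" using j[of n] by (simp add: w_def)
    then show ?thesis unfolding G_def by (intro suminf_pos2[OF sumw, of _ n] w0)
  qed
  have Glim: "(\<lambda>n. G (s n)) \<longlonglongrightarrow> 0"
    using continuous_on_tendsto_compose[OF contG lim] by (simp add: Gx)
  have "\<exists>\<sigma>. \<forall>n. True \<and> (\<sigma> n < \<sigma> (Suc n) \<and> G (s (\<sigma> (Suc n))) < G (s (\<sigma> n)) / 2)"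
  proof (rule dependent_nat_choice)
    fix k n :: nat
    have "\<forall>\<^sub>F m in sequentially. G (s m) < G (s k) / 2"
      using order_tendstoD(2)[OF Glim, of "G (s k) / 2"] Gpos[of k] by simp
    then have "\<forall>\<^sub>F m in sequentially. k < m \<and> G (s m) < G (s k) / 2"
      using eventually_gt_at_top[of k] by eventually_elim simp
    then show "\<exists>m. True \<and> (k < m \<and> G (s m) < G (s k) / 2)"
      using eventually_happens'[OF sequentially_bot] by blast
  qed simp
  then obtain \<sigma> where \<sigma>: "\<And>n. \<sigma> n < \<sigma> (Suc n)" "\<And>n. G (s (\<sigma> (Suc n))) < G (s (\<sigma> n)) / 2" by blast
  define t where "t n = G (s (\<sigma> n))" for n
  have tpos: "0 < t n" for n by (simp add: t_def Gpos)
  have half: "t n < t m / 2" if "m < n" for m n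
    using that
  proof (induction rule: less_Suc_induct)
    case (1 i) then show ?case using \<sigma>(2) by (simp add: t_def)
  next
    case (2 i j k) then show ?case using tpos[of j] by simp
  qed
  \<comment> \<open>The bump is nonzero only where \<open>G y\<close> lies strictly between 3/4 and
    5/4 of \<open>t n\<close>. As \<open>t n < t m / 2\<close> for \<open>m < n\<close>, and 5/8 is
    below 3/4, these ranges are disjoint.\<close>
  define u where "u n y = max 0 (t n / 4 - \<bar>G y - t n\<bar>)" for n y
  have disj: "u m y = 0 \<or> u n y = 0" if "m < n" for m n y
    using half[OF that] tpos[of m] tpos[of n] by (auto simp: u_def max_def abs_if split: if_splits)
  show ?thesis
  proof (rule that[of \<sigma> "range j" u])
    show "strict_mono \<sigma>" using \<sigma>(1) by (simp add: strict_mono_Suc_iff)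
    show "continuous_on UNIV (u n)" for n unfolding u_def by (intro continuous_intros contG)
    show "0 \<le> u n y" for n y by (simp add: u_def)
    show "0 < u n (s (\<sigma> n))" for n using tpos[of n] by (simp add: u_def t_def)
    show "u n x = 0" for n using tpos[of n] by (simp add: u_def Gx)
    show "u m y = 0 \<or> u n y = 0" if "m \<noteq> n" for m n y
      using that disj[of m n y] disj[of n m y] by (meson linorder_neqE_nat)
    show "u n y = u n y'" if "\<And>i. i \<in> range j \<Longrightarrow> \<phi> y i = \<phi> y' i" for n y y'
    proof -
      have "w n y = w n y'" for n using that by (simp add: w_def)
      then show ?thesis by (simp add: u_def G_def)
    qed
  qed simp
qed

text \<open>\<open>L c\<close> is the hull of \<open>J\<close> and all earlier \<open>H b\<close>,
  which is countable because \<open>c\<close> has countably many predecessors. Each uncountable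
  \<open>supp n\<close> therefore has a point outside \<open>L c\<close>, and \<open>H c\<close> is
  the hull after adding one such point for every \<open>n\<close>. For total \<open>r\<close> the
  differences of \<open>H c\<close> and \<open>L c\<close> are pairwise disjoint.\<close>

lemma wellordered_layers:
  fixes r :: "('c \<times> 'c) set" and cl :: "'i set \<Rightarrow> 'i set" and supp :: "nat \<Rightarrow> 'i set"
  assumes "wf r" and count: "\<And>c. countable {b. (b, c) \<in> r}"
    and hull: "\<forall>S. S \<subseteq> cl S \<and> (countable S \<longrightarrow> countable (cl S))"
    and J: "countable J" and supp: "\<And>n. uncountable (supp n)"
  shows "\<exists>L H. \<forall>c. L c \<in> range cl \<and> H c \<in> range cl \<and> J \<subseteq> L c \<and> L c \<subseteq> H c
    \<and> (\<forall>b. (b, c) \<in> r \<longrightarrow> H b \<subseteq> L c) \<and> (\<forall>n. \<exists>i \<in> supp n. i \<in> H c \<and> i \<notin> L c)"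
proof -
  have cl: "S \<subseteq> cl S" "countable S \<Longrightarrow> countable (cl S)" for S using hull by blast+
  define P :: "('c \<Rightarrow> 'i set \<times> 'i set) \<Rightarrow> 'c \<Rightarrow> 'i set \<times> 'i set \<Rightarrow> bool" where
    "P f c LH \<longleftrightarrow> fst LH \<in> range cl \<and> snd LH \<in> range cl \<and> J \<subseteq> fst LH \<and> fst LH \<subseteq> snd LH
      \<and> countable (snd LH) \<and> (\<forall>b. (b, c) \<in> r \<longrightarrow> snd (f b) \<subseteq> fst LH)
      \<and> (\<forall>n. \<exists>i \<in> supp n. i \<in> snd LH \<and> i \<notin> fst LH)" for f c LH
  have "\<exists>f. \<forall>c. P f c (f c)"
  proof (rule dependent_wf_choice[OF \<open>wf r\<close>])
    show "P f c y = P g c y" if "\<And>z. (z, c) \<in> r \<Longrightarrow> f z = g z" for f g c y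
      using that by (auto simp: P_def)
  next
    fix c f assume prev: "\<And>b. (b, c) \<in> r \<Longrightarrow> P f b (f b)"
    define L0 where "L0 = cl (J \<union> (\<Union>b\<in>{b. (b, c) \<in> r}. snd (f b)))"
    have cL: "countable L0" unfolding L0_def
      using prev by (intro cl countable_Un J countable_UN count) (auto simp: P_def)
    have "\<exists>i. i \<in> supp n - L0" for n
      using uncountable_minus_countable[OF supp cL, of n] by (metis countable_empty ex_in_conv)
    then obtain j where j: "\<And>n. j n \<in> supp n - L0" by metis
    define H0 where "H0 = cl (L0 \<union> range j)"
    have "J \<union> (\<Union>b\<in>{b. (b, c) \<in> r}. snd (f b)) \<subseteq> L0" "L0 \<union> range j \<subseteq> H0"
      unfolding L0_def H0_def by (rule cl)+
    moreover have "countable H0" unfolding H0_def by (intro cl) (simp add: cL)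
    moreover have "L0 \<in> range cl" "H0 \<in> range cl" by (simp_all add: L0_def H0_def)
    moreover have "\<exists>i \<in> supp n. i \<in> H0 \<and> i \<notin> L0" for n using j[of n] calculation(2) by blast
    ultimately have "P f c (L0, H0)" unfolding P_def by (auto simp del: UN_subset_iff)
    then show "\<exists>y. P f c y" ..
  qed
  then obtain f where f: "\<And>c. P f c (f c)" by blast
  then show ?thesis
    unfolding P_def by (intro exI[of _ "\<lambda>c. fst (f c)"] exI[of _ "\<lambda>c. snd (f c)"]) simp
qed

lemma continuous_bounded_compact:
  fixes f :: "'a::topological_space \<Rightarrow> real"
  assumes "compact (UNIV :: 'a set)" "continuous_on UNIV f"
  shows "\<exists>B. \<forall>x. \<bar>f x\<bar> \<le> B"
proof -
  have "bounded (range f)"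
    using compact_continuous_image[OF assms(2,1)] by (rule compact_imp_bounded)
  then show ?thesis by (auto simp: bounded_iff)
qed

text \<open>The functions with this property form an algebra containing the constants and the
  coordinates: a truncation keeps or kills a coordinate, so convergence there is uniform in
  \<open>c\<close>. Stone-Weierstrass and a three-epsilon estimate give all continuous
  \<open>f\<close>.\<close>

lemma uniform_limit_truncations:
  fixes \<phi> :: "'a::t2_space \<Rightarrow> ('i \<Rightarrow> real)" and P :: "'c \<Rightarrow> 'a \<Rightarrow> 'a"
  assumes compact: "compact (UNIV :: 'a set)" and cont: "continuous_on UNIV \<phi>" and "inj \<phi>"
    and lim: "s \<longlonglongrightarrow> x"
    and P: "\<And>c y i. y \<in> insert x (range s) \<Longrightarrow> \<phi> (P c y) i = (if i \<in> T c then \<phi> y i else 0)"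
    and f: "continuous_on UNIV (f :: 'a \<Rightarrow> real)"
  shows "uniform_limit UNIV (\<lambda>n c. f (P c (s n))) (\<lambda>c. f (P c x)) sequentially"
proof -
  have coord: "continuous_on UNIV (\<lambda>y. \<phi> y i)" for i
    using cont by (rule continuous_on_product_then_coordinatewise)
  define good where "good f \<longleftrightarrow> continuous_on UNIV f \<and>
    uniform_limit UNIV (\<lambda>n c. f (P c (s n))) (\<lambda>c. f (P c x) :: real) sequentially" for f
  have approx: "\<exists>g. good g \<and> (\<forall>y\<in>UNIV. \<bar>f y - g y\<bar> < e)" if "e > 0" for e
  proof (rule Stone_Weierstrass_HOL[OF compact _ _ _ _ _ f that])
    show "good (\<lambda>_. c)" for c by (auto simp: good_def intro: uniform_limit_const)
    show "good f \<Longrightarrow> continuous_on UNIV f" for f by (simp add: good_def)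
    show "good f \<and> good g \<Longrightarrow> good (\<lambda>x. f x + g x)" for f g
      by (auto simp: good_def intro: uniform_limit_add continuous_intros)
    show "good (\<lambda>x. f x * g x)" if fg: "good f \<and> good g" for f g
    proof -
      obtain B B' where "\<And>x. \<bar>f x\<bar> \<le> B" "\<And>x. \<bar>g x\<bar> \<le> B'"
        using fg continuous_bounded_compact[OF compact, of f]
          continuous_bounded_compact[OF compact, of g] unfolding good_def by blast
      then have "bounded ((\<lambda>c. f (P c x)) ` UNIV)" "bounded ((\<lambda>c. g (P c x)) ` UNIV)"
        by (auto simp: bounded_iff)
      then show ?thesis
        using that by (auto simp: good_def intro: uniform_lim_mult continuous_intros)
    qed
    have "good (\<lambda>y. \<phi> y i)" for i
    proof -
      have ev: "\<forall>\<^sub>F n in sequentially. \<bar>\<phi> (s n) i - \<phi> x i\<bar> < e" if "e > 0" for e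
        using tendstoD[OF continuous_on_tendsto_compose[OF coord lim] that, of i] by (simp add: dist_norm)
      have "uniform_limit UNIV (\<lambda>n c. \<phi> (P c (s n)) i) (\<lambda>c. \<phi> (P c x) i) sequentially"
      proof (rule uniform_limitI)
        fix e :: real assume "e > 0"
        from ev[OF this] show "\<forall>\<^sub>F n in sequentially. \<forall>c\<in>UNIV. dist (\<phi> (P c (s n)) i) (\<phi> (P c x) i) < e"
          by eventually_elim (use \<open>e > 0\<close> in \<open>auto simp: P dist_norm\<close>)
      qed
      then show ?thesis by (simp add: good_def coord)
    qed
    then show "\<exists>f. good f \<and> f y \<noteq> f y'" if "y \<in> UNIV \<and> y' \<in> UNIV \<and> y \<noteq> y'" for y y'
      using that \<open>inj \<phi>\<close> by (metis ext injD)
  qed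
  show ?thesis
  proof (rule uniform_limitI)
    fix e :: real assume "e > 0"
    then obtain g where g: "good g" "\<And>y. \<bar>f y - g y\<bar> < e/3" using approx[of "e/3"] by auto
    have "\<forall>\<^sub>F n in sequentially. \<forall>c\<in>UNIV. dist (g (P c (s n))) (g (P c x)) < e/3"
      using g(1) \<open>e > 0\<close> by (intro uniform_limitD) (auto simp: good_def)
    then show "\<forall>\<^sub>F n in sequentially. \<forall>c\<in>UNIV. dist (f (P c (s n))) (f (P c x)) < e"
    proof eventually_elim
      case (elim n)
      show ?case
      proof
        fix c
        show "dist (f (P c (s n))) (f (P c x)) < e"
          using elim[rule_format, of c] g(2)[of "P c (s n)"] g(2)[of "P c x"]
          by (simp add: dist_real_def abs_if split: if_splits)
      qed
    qed
  qed
qed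

text \<open>The functions whose jumps tend to 0 along the cofinite filter form an algebra with the
  constants and the coordinates, each coordinate having finitely many nonzero jumps.
  Stone-Weierstrass extends this to all continuous functions.\<close>

lemma finite_large_jumps:
  fixes \<phi> :: "'a::t2_space \<Rightarrow> ('i \<Rightarrow> real)" and p q :: "'c \<Rightarrow> 'a"
  assumes compact: "compact (UNIV :: 'a set)" and cont: "continuous_on UNIV \<phi>" and "inj \<phi>"
    and jump: "\<And>i. finite {c. \<phi> (q c) i \<noteq> \<phi> (p c) i}"
    and f: "continuous_on UNIV (f :: 'a \<Rightarrow> real)" and e: "e > 0"
  shows "finite {c. e \<le> \<bar>f (q c) - f (p c)\<bar>}"
proof -
  have coord: "continuous_on UNIV (\<lambda>y. \<phi> y i)" for i
    using cont by (rule continuous_on_product_then_coordinatewise)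
  define good where "good f \<longleftrightarrow> continuous_on UNIV f \<and>
    ((\<lambda>c. f (q c) - f (p c) :: real) \<longlongrightarrow> 0) cofinite" for f
  have approx: "\<exists>g. good g \<and> (\<forall>y\<in>UNIV. \<bar>f y - g y\<bar> < e)" if "e > 0" for e
  proof (rule Stone_Weierstrass_HOL[OF compact _ _ _ _ _ f that])
    show "good (\<lambda>_. c)" for c by (auto simp: good_def)
    show "good f \<Longrightarrow> continuous_on UNIV f" for f by (simp add: good_def)
    show "good (\<lambda>x. f x + g x)" if "good f \<and> good g" for f g
    proof -
      have "((\<lambda>c. (f (q c) - f (p c)) + (g (q c) - g (p c))) \<longlongrightarrow> 0) cofinite"
        using that by (intro tendsto_add_zero) (auto simp: good_def)
      then show ?thesis using that by (auto simp: good_def algebra_simps intro: continuous_intros)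
    qed
    show "good (\<lambda>x. f x * g x)" if fg: "good f \<and> good g" for f g
    proof -
      obtain B B' where B: "\<And>x. \<bar>f x\<bar> \<le> B" "\<And>x. \<bar>g x\<bar> \<le> B'"
        using fg continuous_bounded_compact[OF compact, of f]
          continuous_bounded_compact[OF compact, of g] unfolding good_def by blast
      have *: "((\<lambda>c. B' * \<bar>f (q c) - f (p c)\<bar> + B * \<bar>g (q c) - g (p c)\<bar>) \<longlongrightarrow> 0) cofinite"
        using that by (intro tendsto_add_zero tendsto_mult_right_zero tendsto_rabs_zero) (auto simp: good_def)
      have "((\<lambda>c. f (q c) * g (q c) - f (p c) * g (p c)) \<longlongrightarrow> 0) cofinite"
      proof (rule Lim_null_comparison[OF _ *], rule always_eventually, rule allI)
        fix c
        have "f (q c) * g (q c) - f (p c) * g (p c)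
            = g (q c) * (f (q c) - f (p c)) + f (p c) * (g (q c) - g (p c))" by algebra
        also have "norm \<dots> \<le> B' * \<bar>f (q c) - f (p c)\<bar> + B * \<bar>g (q c) - g (p c)\<bar>"
          using B by (intro norm_triangle_mono) (auto simp: abs_mult intro: mult_right_mono)
        finally show "norm (f (q c) * g (q c) - f (p c) * g (p c))
            \<le> B' * \<bar>f (q c) - f (p c)\<bar> + B * \<bar>g (q c) - g (p c)\<bar>" .
      qed
      then show ?thesis using that by (auto simp: good_def intro: continuous_intros)
    qed
    have "good (\<lambda>y. \<phi> y i)" for i
    proof -
      have "\<forall>\<^sub>F c in cofinite. \<phi> (q c) i - \<phi> (p c) i = 0"
        using jump[of i] by (simp add: eventually_cofinite)
      then show ?thesis by (simp add: good_def coord tendsto_eventually)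
    qed
    then show "\<exists>f. good f \<and> f y \<noteq> f y'" if "y \<in> UNIV \<and> y' \<in> UNIV \<and> y \<noteq> y'" for y y'
      using that \<open>inj \<phi>\<close> by (metis ext injD)
  qed
  obtain g where g: "good g" "\<And>y. \<bar>f y - g y\<bar> < e/3" using approx[of "e/3"] e by auto
  have "\<forall>\<^sub>F c in cofinite. dist (g (q c) - g (p c)) 0 < e/3"
    using g(1) e by (intro tendstoD) (auto simp: good_def)
  then have "\<forall>\<^sub>F c in cofinite. \<bar>f (q c) - f (p c)\<bar> < e"
  proof eventually_elim
    case (elim c)
    then show ?case using g(2)[of "q c"] g(2)[of "p c"]
      by (simp add: abs_if split: if_splits)
  qed
  then show ?thesis by (simp add: eventually_cofinite not_less)
qed

subsection \<open>The nontrivial twisted sum\<close>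

text \<open>A coordinate that is nonzero at the limit is nonzero at some term, so the support of the
  limit lies in a countable union of countable sets. Consequently a sequence converging to a point
  outside the Sigma-subset has only finitely many terms in it.\<close>

lemma Sigma_prod_sequentially_closed:
  fixes \<phi> :: "'a::topological_space \<Rightarrow> ('i \<Rightarrow> real)"
  assumes cont: "continuous_on UNIV \<phi>" and lim: "s \<longlonglongrightarrow> x" and s: "\<And>n. \<phi> (s n) \<in> Sigma_prod"
  shows "\<phi> x \<in> Sigma_prod"
proof -
  have "{i. \<phi> x i \<noteq> 0} \<subseteq> (\<Union>n. {i. \<phi> (s n) i \<noteq> 0})"
  proof (rule ccontr)
    assume "\<not> ?thesis"
    then obtain i where i: "\<phi> x i \<noteq> 0" "\<And>n. \<phi> (s n) i = 0" by blast
    have "(\<lambda>n. \<phi> (s n) i) \<longlonglongrightarrow> \<phi> x i"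
      using continuous_on_tendsto_compose[OF continuous_on_product_then_coordinatewise[OF cont] lim]
      by simp
    then show False using i by (simp add: LIMSEQ_const_iff)
  qed
  then show ?thesis
    using s unfolding Sigma_prod_def by (auto intro: countable_subset)
qed

theorem theorem3p4:
  fixes \<phi> :: "'a::t2_space \<Rightarrow> ('i \<Rightarrow> real)"
    and A :: "'a set"
  assumes "CH"
    and "compact (UNIV :: 'a set)"
    and "continuous_on UNIV \<phi>" and "inj \<phi>"
    and "A = \<phi> -` Sigma_prod"
    and "closure A = UNIV"
    and "\<exists>x s. x \<notin> A \<and> s \<longlonglongrightarrow> x \<and> \<not> (\<exists>N. \<forall>n\<ge>N. s n = s N)"
  shows "nontrivial_twisted_sum_c0_CK TYPE('a)"
proof -
  note compact = assms(2) and cont = assms(3)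

  \<comment> \<open>Reduction to a separated sequence of points with uncountable support\<close>
  obtain x s0 where x: "x \<notin> A" and lim0: "s0 \<longlonglongrightarrow> x" and nontriv: "\<nexists>N. \<forall>n\<ge>N. s0 n = s0 N"
    using assms(7) by blast
  have inf1: "infinite {n. s0 n \<noteq> x}"
  proof
    assume "finite {n. s0 n \<noteq> x}"
    then obtain N where "\<forall>n\<ge>N. s0 n = x"
      by (metis (mono_tags, lifting) finite_nat_set_iff_bounded linorder_not_less mem_Collect_eq)
    then show False using nontriv by (metis order_refl)
  qed
  have fin2: "finite {n. s0 n \<in> A}"
  proof (rule ccontr)
    assume inf: "infinite {n. s0 n \<in> A}"
    have lim': "(s0 \<circ> enumerate {n. s0 n \<in> A}) \<longlonglongrightarrow> x"
      by (rule LIMSEQ_subseq_LIMSEQ[OF lim0 strict_mono_enumerate[OF inf]])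
    have "\<phi> ((s0 \<circ> enumerate {n. s0 n \<in> A}) n) \<in> Sigma_prod" for n
      using enumerate_in_set[OF inf, of n] unfolding assms(5) by simp
    then have "\<phi> x \<in> Sigma_prod"
      by (rule Sigma_prod_sequentially_closed[OF cont lim'])
    then show False using x assms(5) by simp
  qed
  define E where "E = {n. s0 n \<noteq> x} - {n. s0 n \<in> A}"
  have infE: "infinite E" unfolding E_def using inf1 fin2 by (rule Diff_infinite_finite[rotated])
  define s1 where "s1 = s0 \<circ> enumerate E"
  have lim1: "s1 \<longlonglongrightarrow> x"
    unfolding s1_def by (rule LIMSEQ_subseq_LIMSEQ[OF lim0 strict_mono_enumerate[OF infE]])
  have s1: "s1 n \<noteq> x" "s1 n \<notin> A" for n
    using enumerate_in_set[OF infE, of n] by (auto simp: s1_def E_def)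
  obtain \<sigma> :: "nat \<Rightarrow> nat" and J u where \<sigma>: "strict_mono \<sigma>" and J: "countable J"
    and ucont: "\<And>n. continuous_on UNIV (u n)" and u0: "\<And>n y. 0 \<le> u n y"
    and upos1: "\<And>n. 0 < u n (s1 (\<sigma> n))" and ux: "\<And>n. u n x = (0::real)"
    and udisj: "\<And>m n y. m \<noteq> n \<Longrightarrow> u m y = 0 \<or> u n y = 0"
    and uJ: "\<And>n y y'. (\<And>i. i \<in> J \<Longrightarrow> \<phi> y i = \<phi> y' i) \<Longrightarrow> u n y = u n y'"
    using separated_subsequence[OF cont assms(4) lim1 s1(1)] by blast
  define s where "s = s1 \<circ> \<sigma>"
  have lim: "s \<longlonglongrightarrow> x" unfolding s_def by (rule LIMSEQ_subseq_LIMSEQ[OF lim1 \<sigma>])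
  have upos: "0 < u n (s n)" for n using upos1 by (simp add: s_def)
  have unc: "uncountable {i. \<phi> (s n) i \<noteq> 0}" for n
    using s1(2)[of "\<sigma> n"] assms(5) by (simp add: s_def Sigma_prod_def)

  \<comment> \<open>The index set, the almost disjoint family and the truncations\<close>
  obtain r :: "((nat \<Rightarrow> nat set) \<times> (nat \<Rightarrow> nat set)) set"
    where r: "wf r" "\<And>a b. a \<noteq> b \<Longrightarrow> (a, b) \<in> r \<or> (b, a) \<in> r" "\<And>a. countable {b. (b, a) \<in> r}"
    using CH_wellorder[OF \<open>CH\<close>] by blast
  obtain M :: "(nat \<Rightarrow> nat set) \<Rightarrow> nat set" and \<nu>
    where M: "\<And>B. infinite (M B)" "\<And>B B'. B \<noteq> B' \<Longrightarrow> finite (M B \<inter> M B')"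
      "\<And>B K. bounded_overlap K B \<Longrightarrow> M B \<inter> B (\<nu> B) = {}"
    using diagonalizing_almost_disjoint_family[OF r] by blast
  have dense: "closure (\<phi> -` Sigma_prod) = UNIV" using assms(5,6) by simp
  have cY: "countable (insert x (range s))" by simp
  obtain cl :: "'i set \<Rightarrow> 'i set" where hull: "\<forall>S. S \<subseteq> cl S \<and> (countable S \<longrightarrow> countable (cl S))
    \<and> (\<forall>y\<in>insert x (range s). \<exists>z. \<forall>i. \<phi> z i = (if i \<in> cl S then \<phi> y i else 0))"
    using truncation_hull[OF compact cont dense cY] ..
  then have cl: "\<forall>S. S \<subseteq> cl S \<and> (countable S \<longrightarrow> countable (cl S))" by simp
  obtain L H where layers: "\<forall>c. L c \<in> range cl \<and> H c \<in> range cl \<and> J \<subseteq> L c \<and> L c \<subseteq> H c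
    \<and> (\<forall>b. (b, c) \<in> r \<longrightarrow> H b \<subseteq> L c)
    \<and> (\<forall>n. \<exists>i \<in> {i. \<phi> (s n) i \<noteq> 0}. i \<in> H c \<and> i \<notin> L c)"
    using wellordered_layers[where supp = "\<lambda>n. {i. \<phi> (s n) i \<noteq> 0}", OF r(1,3) cl J unc]
    by (elim exE) (rule that)
  have LH: "L c \<in> range cl" "H c \<in> range cl" "J \<subseteq> L c" "L c \<subseteq> H c" "(b, c) \<in> r \<Longrightarrow> H b \<subseteq> L c"
    and meets: "\<exists>i \<in> {i. \<phi> (s n) i \<noteq> 0}. i \<in> H c \<and> i \<notin> L c" for b c n
    using spec[OF layers, of c] by blast+
  \<comment> \<open>The choice is meaningful for \<open>T\<close> in the range of \<open>cl\<close>
    and \<open>y\<close> equal to \<open>x\<close> or a term of \<open>s\<close>; elsewhere the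
    value is arbitrary.\<close>
  define trc where "trc T y = (SOME z. \<forall>i. \<phi> z i = (if i \<in> T then \<phi> y i else 0))" for T y
  have trc: "\<phi> (trc T y) i = (if i \<in> T then \<phi> y i else 0)" if T: "T \<in> range cl" and y: "y \<in> insert x (range s)" for T y i
  proof -
    obtain S where S: "T = cl S" using T by blast
    have "\<exists>z. \<forall>i. \<phi> z i = (if i \<in> T then \<phi> y i else 0)"
      unfolding S by (rule bspec[OF _ y]) (use hull in simp)
    then have "\<forall>i. \<phi> (trc T y) i = (if i \<in> T then \<phi> y i else 0)"
      unfolding trc_def by (rule someI_ex)
    then show ?thesis by (rule spec)
  qed
  define P where "P c y = trc (L c) y" for c y
  define Q where "Q c y = trc (H c) y" for c y
  have P: "\<phi> (P c y) i = (if i \<in> L c then \<phi> y i else 0)"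
    and Q: "\<phi> (Q c y) i = (if i \<in> H c then \<phi> y i else 0)" if "y \<in> insert x (range s)" for c y i
    using trc[OF LH(1) that] trc[OF LH(2) that] by (simp_all add: P_def Q_def)
  have jump: "finite {c. \<phi> (Q c y) i \<noteq> \<phi> (P c y) i}" if "y \<in> insert x (range s)" for y i
  proof -
    have *: "i \<in> H c \<and> i \<notin> L c" if "\<phi> (Q c y) i \<noteq> \<phi> (P c y) i" for c
      using that P[OF \<open>y \<in> insert x (range s)\<close>] Q[OF \<open>y \<in> insert x (range s)\<close>] LH(4)[of c]
      by (auto split: if_splits)
    \<comment> \<open>Of two distinct indices one precedes the other in \<open>r\<close>, and the
      \<open>H\<close> of the earlier is contained in the \<open>L\<close> of the later.\<close>
    have "b = c" if "i \<in> H b \<and> i \<notin> L b" "i \<in> H c \<and> i \<notin> L c" for b c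
      using that LH(5)[of b c] LH(5)[of c b] r(2)[of b c] by blast
    with * have "{c. \<phi> (Q c y) i \<noteq> \<phi> (P c y) i} \<subseteq> {b}" if "\<phi> (Q b y) i \<noteq> \<phi> (P b y) i" for b
      using that by blast
    then show ?thesis
      by (cases "\<exists>b. \<phi> (Q b y) i \<noteq> \<phi> (P b y) i") (auto intro: finite_subset)
  qed
  \<comment> \<open>A mixed second difference over the corners \<open>s n\<close>, \<open>x\<close>
    and \<open>H c\<close>, \<open>L c\<close>. Differencing in the sequence makes it small for
    large \<open>\<nu> c\<close>, uniformly in \<open>c\<close>; differencing in the layers makes it
    small for almost all \<open>c\<close> when the point is fixed.\<close>
  define g :: "(nat \<Rightarrow> nat set) \<Rightarrow> ('a \<Rightarrow>\<^sub>C real) \<Rightarrow> real" where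
    "g c f = f (Q c (s (\<nu> c))) - f (P c (s (\<nu> c))) - f (Q c x) + f (P c x)" for c f
  interpret almost_disjoint_functionals M g 4
  proof (rule almost_disjoint_functionals.intro)
    show "complete (UNIV :: ('a \<Rightarrow>\<^sub>C real) set)" by (rule complete_UNIV_bcontfun)
    show "B \<noteq> B' \<Longrightarrow> finite (M B \<inter> M B')" for B B' by (rule M)
    show "linear (g c)" for c by (rule linearI) (simp_all add: g_def algebra_simps)
    show "\<bar>g c f\<bar> \<le> 4 * norm f" for c f
      using abs_apply_le_norm[of f "Q c (s (\<nu> c))"] abs_apply_le_norm[of f "P c (s (\<nu> c))"]
        abs_apply_le_norm[of f "Q c x"] abs_apply_le_norm[of f "P c x"]
      unfolding g_def by linarith
    show "finite {c. e \<le> \<bar>g c f\<bar>}" if "e > 0" for e f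
    proof -
      have e2: "e/2 > 0" using that by simp
      have uP: "uniform_limit UNIV (\<lambda>n c. f (P c (s n))) (\<lambda>c. f (P c x)) sequentially"
        by (rule uniform_limit_truncations[OF compact cont assms(4) lim P]) auto
      have uQ: "uniform_limit UNIV (\<lambda>n c. f (Q c (s n))) (\<lambda>c. f (Q c x)) sequentially"
        by (rule uniform_limit_truncations[OF compact cont assms(4) lim Q]) auto
      obtain N where N: "\<And>n c. n \<ge> N \<Longrightarrow> dist (f (P c (s n))) (f (P c x)) < e/2 \<and> dist (f (Q c (s n))) (f (Q c x)) < e/2"
        using eventually_conj[OF uniform_limitD[OF uP e2] uniform_limitD[OF uQ e2]]
        unfolding eventually_sequentially by auto
      define F where "F y = {c. e/2 \<le> \<bar>f (Q c y) - f (P c y)\<bar>}" for y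
      have F: "finite (F y)" if "y \<in> insert x (range s)" for y
        unfolding F_def by (rule finite_large_jumps[OF compact cont assms(4) jump[OF that] _ e2]) auto
      \<comment> \<open>For \<open>\<nu> c\<close> at least \<open>N\<close> uniform convergence
        gives a value below \<open>e\<close>. Otherwise a large value forces a jump of at least
        \<open>e/2\<close> at \<open>x\<close> or at one of the first \<open>N\<close>
        terms.\<close>
      have "{c. e \<le> \<bar>g c f\<bar>} \<subseteq> F x \<union> (\<Union>n<N. F (s n))"
      proof
        fix c assume c: "c \<in> {c. e \<le> \<bar>g c f\<bar>}"
        have "\<nu> c < N"
        proof (rule ccontr)
          assume "\<not> ?thesis"
          then show False using N[of "\<nu> c" c] c by (auto simp: g_def dist_real_def abs_if split: if_splits)
        qed
        moreover have "c \<in> F x \<or> c \<in> F (s (\<nu> c))"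
          using c by (auto simp: g_def F_def abs_if split: if_splits)
        ultimately show "c \<in> F x \<union> (\<Union>n<N. F (s n))" by blast
      qed
      then show ?thesis by (rule finite_subset) (auto intro: F)
    qed
  qed

  \<comment> \<open>Test functions with disjoint supports\<close>
  have "\<exists>f. g c f = 1 \<and> (\<forall>y. 0 \<le> apply_bcontfun f y \<and> apply_bcontfun f y \<le> 1)
      \<and> (\<forall>y. u (\<nu> c) y = 0 \<longrightarrow> apply_bcontfun f y = 0)" for c
  proof -
    define n where "n = \<nu> c"
    obtain j where j: "\<phi> (s n) j \<noteq> 0" "j \<in> H c" "j \<notin> L c" using meets by blast
    \<comment> \<open>Normalized to be 1 at \<open>Q c (s n)\<close>. It vanishes at the other three
      corners: coordinate \<open>j\<close> is killed by \<open>P c\<close>, and \<open>u n\<close>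
      is zero at both truncations of \<open>x\<close> because they agree with \<open>x\<close> on
      \<open>J\<close>.\<close>
    define h where "h y = min 1 (u n y * \<bar>\<phi> y j\<bar> / (u n (s n) * \<bar>\<phi> (s n) j\<bar>))" for y
    have h01: "0 \<le> h y" "h y \<le> 1" for y using u0 by (auto simp: h_def)
    have "continuous_on UNIV h" unfolding h_def using upos[of n] j(1)
      by (intro continuous_intros ucont continuous_on_product_then_coordinatewise[OF cont]) auto
    then have "h \<in> bcontfun" by (rule bcontfun_normI[where b = 1]) (use h01 in auto)
    then obtain f where f: "apply_bcontfun f y = h y" for y by (metis Bcontfun_inverse)
    have "u n (Q c (s n)) = u n (s n)" "u n (Q c x) = u n x" "u n (P c x) = u n x"
      by (rule uJ; use LH(3,4) in \<open>auto simp: P Q subset_iff\<close>)+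
    then have "g c f = 1" using upos[of n] j
      by (simp add: g_def f h_def n_def[symmetric] ux P Q)
    moreover have "h y = 0" if "u n y = 0" for y using that by (simp add: h_def)
    ultimately show ?thesis using f h01 by (metis n_def)
  qed
  then obtain F where F: "\<And>c. g c (F c) = 1" "\<And>c y. 0 \<le> apply_bcontfun (F c) y"
      "\<And>c y. apply_bcontfun (F c) y \<le> 1" "\<And>c y. u (\<nu> c) y = 0 \<Longrightarrow> apply_bcontfun (F c) y = 0"
    by metis

  \<comment> \<open>Contradiction from a bounded lift\<close>
  have "\<not> complemented_in ((\<lambda>y. (y, 0)) ` c0) Z norm"
  proof
    assume "complemented_in ((\<lambda>y. (y, 0)) ` c0) Z norm"
    then obtain S C where S: "linear S" "\<And>f. norm (S f) \<le> C * norm f" "\<And>f. (S f, f) \<in> Z"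
      by (rule bounded_lifting) blast
    define B where "B n = {k. \<exists>c. \<nu> c = n \<and> 1/2 \<le> \<bar>apply_bcontfun (S (F c)) k\<bar>}" for n
    have "card T \<le> nat \<lceil>2 * \<bar>C\<bar>\<rceil>" if finT: "finite T" and T: "\<forall>n\<in>T. k \<in> B n" for k T
    proof -
      obtain c where c: "\<And>n. n \<in> T \<Longrightarrow> \<nu> (c n) = n"
          "\<And>n. n \<in> T \<Longrightarrow> 1/2 \<le> \<bar>apply_bcontfun (S (F (c n))) k\<bar>"
        using T unfolding B_def mem_Collect_eq by metis
      \<comment> \<open>With these signs every index in \<open>T\<close> contributes at least 1/2 to
        \<open>S h\<close> at \<open>k\<close>, whereas \<open>norm h\<close> is at most 1 since the
        functions \<open>F (c n)\<close> have disjoint supports. Hence \<open>card T\<close> is at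
        most twice the bound of the lift.\<close>
      define a where "a n = sgn (apply_bcontfun (S (F (c n))) k)" for n
      define h where "h = (\<Sum>n\<in>T. a n *\<^sub>R F (c n))"
      have app: "apply_bcontfun (\<Sum>n\<in>T. v n) y = (\<Sum>n\<in>T. apply_bcontfun (v n) y)"
        for v :: "nat \<Rightarrow> 'b::topological_space \<Rightarrow>\<^sub>C real" and y
        using finT by (induction T) auto
      have "norm h \<le> 1"
      proof (rule norm_bound)
        fix y
        have "\<bar>apply_bcontfun h y\<bar> \<le> (\<Sum>n\<in>T. apply_bcontfun (F (c n)) y)"
          unfolding h_def app
        proof (rule sum_norm_le[where 'a = real, simplified])
          fix n assume "n \<in> T"
          show "\<bar>apply_bcontfun (a n *\<^sub>R F (c n)) y\<bar> \<le> apply_bcontfun (F (c n)) y"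
            using F(2)[of "c n" y] by (simp add: a_def abs_mult abs_sgn_eq)
        qed
        also have "\<dots> \<le> 1"
        proof (cases "\<exists>m\<in>T. u m y \<noteq> 0")
          case True
          then obtain m where m: "m \<in> T" "u m y \<noteq> 0" by blast
          have "apply_bcontfun (F (c n)) y = 0" if "n \<in> T - {m}" for n
            using udisj[of n m y] m that c(1)[of n] by (intro F(4)) auto
          then have "(\<Sum>n\<in>T. apply_bcontfun (F (c n)) y) = apply_bcontfun (F (c m)) y"
            using sum.remove[OF finT m(1), of "\<lambda>n. apply_bcontfun (F (c n)) y"] by simp
          then show ?thesis using F(3) by simp
        next
          case False
          then have "apply_bcontfun (F (c n)) y = 0" if "n \<in> T" for n
            using that c(1)[of n] by (intro F(4)) auto
          then show ?thesis by simp
        qed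
        finally show "norm (apply_bcontfun h y) \<le> 1" by simp
      qed
      have "real (card T) / 2 = (\<Sum>n\<in>T. 1/2)" by simp
      also have "\<dots> \<le> (\<Sum>n\<in>T. a n * apply_bcontfun (S (F (c n))) k)"
        using c(2) by (intro sum_mono) (simp add: a_def sgn_mult_self_eq abs_sgn mult.commute)
      also have "\<dots> = apply_bcontfun (S h) k"
        using S(1) by (simp add: h_def linear_sum linear_scale app)
      also have "\<dots> \<le> norm (S h)" using abs_apply_le_norm[of "S h" k] by linarith
      also have "\<dots> \<le> C * norm h" by (rule S)
      also have "\<dots> \<le> \<bar>C\<bar> * 1" using \<open>norm h \<le> 1\<close> by (intro mult_mono) auto
      finally show ?thesis by linarith
    qed
    then have "bounded_overlap (nat \<lceil>2 * \<bar>C\<bar>\<rceil>) B" by (auto simp: bounded_overlap_def)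
    then have "M B \<inter> B (\<nu> B) = {}" by (rule M)
    \<comment> \<open>The sequence \<open>B\<close> built from the lift is now used as an index.
      Along \<open>M B\<close> the lift of \<open>F B\<close> tends to 1, so almost all of the
      infinite set \<open>M B\<close> would lie in \<open>B (\<nu> B)\<close>, which is disjoint
      from it.\<close>
    moreover have "k \<in> B (\<nu> B)" if "\<bar>apply_bcontfun (S (F B)) k - 1\<bar> < 1/2" for k
    proof -
      have "1/2 \<le> \<bar>apply_bcontfun (S (F B)) k\<bar>" using that by (simp add: abs_if split: if_splits)
      then show ?thesis unfolding B_def[of "\<nu> B"] by blast
    qed
    ultimately have "M B \<subseteq> {k \<in> M B. 1/2 \<le> \<bar>apply_bcontfun (S (F B)) k - g B (F B)\<bar>}"
      by (force simp: F(1) not_le[symmetric])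
    then show False using ZD1[OF S(3)[of "F B"], of "1/2" B] M(1)[of B] finite_subset by auto
  qed
  then show ?thesis
    using twisted_sum_Z unfolding nontrivial_twisted_sum_c0_CK_def by blast
qed

end
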